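(* Let $\mathscr{S}$ be a semiring that is effectively separated by morphisms of finite image. Then the matrix reachability problem, the vector reachability problem, and the scalar reachability problem over $\mathscr{S}$ are decidable.
   Context: A semiring is a set with an addition and a multiplication such that it is a commutative monoid for addition, a monoid for multiplication, multiplication distributes on both sides over addition, and the zero element is absorbing on both sides. The elements of $\mathscr{S}$ are assumed to be represented in some effective way, with sum, product and equality available through oracles. A semiring $\mathscr{S}$ is separated by morphisms of finite image if for all $\gamma\in\mathscr{S}$ there is a finite semiring $\mathscr{S}_\gamma$ and a semiring morphism $\pi_\gamma:\mathscr{S}\to\mathscr{S}_\gamma$ such that $\pi_\gamma^{-1}(\pi_\gamma(\gamma))=\{\gamma\}$. It is effectively separated by morphisms of finite image if moreover the maps $\gamma\mapsto\mathscr{S}_\gamma$ and $\gamma\mapsto\pi_\gamma$ are effective: for any $\gamma\in\mathscr{S}$ one can compute the finite set of elements of $\mathscr{S}_\gamma$ together with its addition and multiplication tables, and one can compute $\pi_\gamma(y)$ for any $y\in\mathscr{S}$. Problems over $\mathscr{S}$ (number of generators $r$ and dimension $n$ arbitrary): - Matrix reachability: given $n\times n$ matrices $A_1,\dots,A_r$ and $M$ with entries in $\mathscr{S}$, is there a finite sequence $1\le i_1,\dots,i_k\le r$ with $k\ge 1$ such that $A_{i_1}\cdots A_{i_k}=M$? - Vector reachability: given $n\times n$ matrices $A_1,\dots,A_r$ and $1\times n$ matrices $\alpha,\eta$ with entries in $\mathscr{S}$, is there a finite sequence $1\le i_1,\dots,i_k\le r$ with $k\ge1$ such that $\alpha A_{i_1}\cdots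 A_{i_k}=\eta$? - Scalar reachability: given $n\times n$ matrices $A_1,\dots,A_r$, a $1\times n$ matrix $\alpha$, an $n\times 1$ matrix $\beta$, all with entries in $\mathscr{S}$, and $\gamma\in\mathscr{S}$, is there a finite sequence $1\le i_1,\dots,i_k\le r$ with $k\ge1$ such that $\alpha A_{i_1}\cdots A_{i_k}\beta=\gamma$? *)

theory Defs
  imports
    "HOL-Algebra.Ring"
    "HOL-Library.Nat_Bijection"
    "Jordan_Normal_Form.Matrix"
begin

section \<open>Partial recursive functions relative to oracles\<close>

text \<open>
  Partial functions of several arguments are partial functions on lists. Arities are not recorded:
  for each fixed number of arguments the class below yields exactly the usual partial recursive
  functions of that arity relative to the oracles.
\<close>

definition succ_fn :: "nat list \<rightharpoonup> nat" where
  "succ_fn xs = (case xs of [x] \<Rightarrow> Some (Suc x) | _ \<Rightarrow> None)"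

definition proj_fn :: "nat \<Rightarrow> nat list \<rightharpoonup> nat" where
  "proj_fn i xs = (if i < length xs then Some (xs ! i) else None)"

definition comp_fn :: "(nat list \<rightharpoonup> nat) \<Rightarrow> (nat list \<rightharpoonup> nat) list \<Rightarrow> nat list \<rightharpoonup> nat" where
  "comp_fn f gs xs =
     (if \<forall>g\<in>set gs. g xs \<noteq> None then f (map (\<lambda>g. the (g xs)) gs) else None)"

definition primrec_fn :: "(nat list \<rightharpoonup> nat) \<Rightarrow> (nat list \<rightharpoonup> nat) \<Rightarrow> nat list \<rightharpoonup> nat" where
  "primrec_fn f g xs =
     (case xs of
        [] \<Rightarrow> None
      | n # ys \<Rightarrow> rec_nat (f ys) (\<lambda>m r. Option.bind r (\<lambda>v. g (m # v # ys))) n)"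

definition mu_fn :: "(nat list \<rightharpoonup> nat) \<Rightarrow> nat list \<rightharpoonup> nat" where
  "mu_fn f xs =
     (if \<exists>n. f (n # xs) = Some 0 \<and> (\<forall>m<n. f (m # xs) \<noteq> None)
      then Some (LEAST n. f (n # xs) = Some 0) else None)"

inductive partial_recursive_in :: "(nat list \<rightharpoonup> nat) set \<Rightarrow> (nat list \<rightharpoonup> nat) \<Rightarrow> bool"
  for Orc where
  Given: "h \<in> Orc \<Longrightarrow> partial_recursive_in Orc h"
| Zero: "partial_recursive_in Orc (\<lambda>_. Some 0)"
| Succ: "partial_recursive_in Orc succ_fn"
| Proj: "partial_recursive_in Orc (proj_fn i)"
| Comp: "partial_recursive_in Orc f \<Longrightarrow> (\<forall>g\<in>set gs. partial_recursive_in Orc g) \<Longrightarrow>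
         partial_recursive_in Orc (comp_fn f gs)"
| Primrec: "partial_recursive_in Orc f \<Longrightarrow> partial_recursive_in Orc g \<Longrightarrow>
            partial_recursive_in Orc (primrec_fn f g)"
| Mu: "partial_recursive_in Orc f \<Longrightarrow> partial_recursive_in Orc (mu_fn f)"

text \<open>
  A problem consists of instances, their codes and the set of positive instances. An instance may
  have several codes, and nothing is required of the algorithm on inputs that are not codes.
\<close>

definition decidable_in ::
    "(nat list \<rightharpoonup> nat) set \<Rightarrow> (nat list \<Rightarrow> 'i \<Rightarrow> bool) \<Rightarrow> ('i \<Rightarrow> bool) \<Rightarrow> bool" where
  "decidable_in Orc codes P \<longleftrightarrow>
     (\<exists>f. partial_recursive_in Orc f \<and>
          (\<forall>xs i. codes xs i \<longrightarrow> f xs = Some (if P i then 1 else 0)))"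

section \<open>Effectively represented semirings\<close>

text \<open>
  \<open>\<nu>\<close> is a partial surjection from codes to elements. It need not be injective, its domain need
  not be decidable, and the oracles may do anything on inputs outside its domain.
\<close>

locale represented_semiring = semiring S
  for S :: "('a, 'm) ring_scheme" (structure) +
  fixes \<nu> :: "nat \<rightharpoonup> 'a" and add_orc mult_orc eq_orc :: "nat list \<rightharpoonup> nat"
  assumes ran_repr: "ran \<nu> = carrier S"
    and add_orc: "\<lbrakk>\<nu> x = Some a; \<nu> y = Some b\<rbrakk> \<Longrightarrow>
      \<exists>z. add_orc [x, y] = Some z \<and> \<nu> z = Some (a \<oplus> b)"
    and mult_orc: "\<lbrakk>\<nu> x = Some a; \<nu> y = Some b\<rbrakk> \<Longrightarrow>
      \<exists>z. mult_orc [x, y] = Some z \<and> \<nu> z = Some (a \<otimes> b)"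
    and eq_orc: "\<lbrakk>\<nu> x = Some a; \<nu> y = Some b\<rbrakk> \<Longrightarrow>
      eq_orc [x, y] = Some (if a = b then 1 else 0)"

section \<open>Separation by morphisms of finite image\<close>

text \<open>\<^const>\<open>ring_hom\<close> does not ask for preservation of zero, which is not automatic here.\<close>

definition semiring_hom :: "('a, 'm) ring_scheme \<Rightarrow> ('b, 'n) ring_scheme \<Rightarrow> ('a \<Rightarrow> 'b) set" where
  "semiring_hom R T = {h \<in> ring_hom R T. h \<zero>\<^bsub>R\<^esub> = \<zero>\<^bsub>T\<^esub>}"

definition separates ::
    "('a, 'm) ring_scheme \<Rightarrow> 'a \<Rightarrow> ('b, 'n) ring_scheme \<Rightarrow> ('a \<Rightarrow> 'b) \<Rightarrow> bool" where
  "separates S \<gamma> T \<pi> \<longleftrightarrow>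
     semiring T \<and> finite (carrier T) \<and> \<pi> \<in> semiring_hom S T \<and>
     {y \<in> carrier S. \<pi> y = \<pi> \<gamma>} = {\<gamma>}"

definition op_table :: "nat set \<Rightarrow> (nat \<Rightarrow> nat \<Rightarrow> nat) \<Rightarrow> nat set" where
  "op_table C f = (\<lambda>(a, b). list_encode [a, b, f a b]) ` (C \<times> C)"

definition finite_semiring_code :: "nat ring \<Rightarrow> nat" where
  "finite_semiring_code T =
     list_encode [set_encode (carrier T),
                  set_encode (op_table (carrier T) (add T)),
                  set_encode (op_table (carrier T) (mult T))]"

text \<open>
  The finite semirings \<open>F \<gamma>\<close> live on natural numbers, which is no loss of generality. From a code
  \<open>x\<close> of \<open>\<gamma>\<close> the function \<open>p\<close> computes the elements and the tables of \<open>F \<gamma>\<close> up to a renaming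
  \<open>h\<close> of the elements, which may depend on \<open>x\<close>; \<open>q\<close> computes \<open>\<pi> \<gamma>\<close> under the same renaming.
\<close>

definition effectively_separated ::
    "('a, 'm) ring_scheme \<Rightarrow> (nat \<rightharpoonup> 'a) \<Rightarrow> (nat list \<rightharpoonup> nat) set \<Rightarrow> bool" where
  "effectively_separated S \<nu> Orc \<longleftrightarrow>
     (\<exists>(F :: 'a \<Rightarrow> nat ring) \<pi>.
        (\<forall>\<gamma>\<in>carrier S. separates S \<gamma> (F \<gamma>) (\<pi> \<gamma>)) \<and>
        (\<exists>p q. partial_recursive_in Orc p \<and> partial_recursive_in Orc q \<and>
           (\<forall>x \<gamma>. \<nu> x = Some \<gamma> \<longrightarrow>
              (\<exists>(T :: nat ring) h.
                 semiring T \<and> h \<in> semiring_hom T (F \<gamma>) \<and>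
                 bij_betw h (carrier T) (carrier (F \<gamma>)) \<and>
                 p [x] = Some (finite_semiring_code T) \<and>
                 (\<forall>y b. \<nu> y = Some b \<longrightarrow>
                    (\<exists>t\<in>carrier T. q [x, y] = Some t \<and> h t = \<pi> \<gamma> b))))))"

section \<open>Matrices over a semiring and the reachability problems\<close>

text \<open>
  Matrix multiplication of \<open>Jordan_Normal_Form.Matrix\<close> uses the type class operations; here the
  operations are those of the structure \<open>R\<close>.
\<close>

definition mat_mult :: "('a, 'm) ring_scheme \<Rightarrow> 'a mat \<Rightarrow> 'a mat \<Rightarrow> 'a mat" where
  "mat_mult R A B =
     mat (dim_row A) (dim_col B)
       (\<lambda>(i, j). \<Oplus>\<^bsub>R\<^esub>k\<in>{0..<dim_col A}. A $$ (i, k) \<otimes>\<^bsub>R\<^esub> B $$ (k, j))"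

text \<open>Only meaningful for a nonempty list of indices.\<close>

definition word_prod :: "('a, 'm) ring_scheme \<Rightarrow> 'a mat list \<Rightarrow> nat list \<Rightarrow> 'a mat" where
  "word_prod R As w = foldl (mat_mult R) (As ! hd w) (map ((!) As) (tl w))"

definition words :: "nat \<Rightarrow> nat list set" where
  "words r = {w. w \<noteq> [] \<and> set w \<subseteq> {0..<r}}"

definition matrix_reachable ::
    "('a, 'm) ring_scheme \<Rightarrow> nat \<times> 'a mat list \<times> 'a mat \<Rightarrow> bool" where
  "matrix_reachable S = (\<lambda>(n, As, M). \<exists>w\<in>words (length As). word_prod S As w = M)"

definition vector_reachable ::
    "('a, 'm) ring_scheme \<Rightarrow> nat \<times> 'a mat list \<times> 'a mat \<times> 'a mat \<Rightarrow> bool" where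
  "vector_reachable S =
     (\<lambda>(n, As, \<alpha>, \<eta>). \<exists>w\<in>words (length As). mat_mult S \<alpha> (word_prod S As w) = \<eta>)"

definition scalar_reachable ::
    "('a, 'm) ring_scheme \<Rightarrow> nat \<times> 'a mat list \<times> 'a mat \<times> 'a mat \<times> 'a \<Rightarrow> bool" where
  "scalar_reachable S =
     (\<lambda>(n, As, \<alpha>, \<beta>, \<gamma>). \<exists>w\<in>words (length As).
        mat_mult S (mat_mult S \<alpha> (word_prod S As w)) \<beta> $$ (0, 0) = \<gamma>)"

text \<open>A matrix is coded by its list of rows, each row being the list of codes of its entries.\<close>

definition codes_mat :: "(nat \<rightharpoonup> 'a) \<Rightarrow> nat \<Rightarrow> 'a mat \<Rightarrow> bool" where
  "codes_mat \<nu> c A \<longleftrightarrow>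
     (\<exists>C. map_mat \<nu> C = map_mat Some A \<and> c = list_encode (map list_encode (mat_to_list C)))"

definition codes_mats :: "(nat \<rightharpoonup> 'a) \<Rightarrow> nat \<Rightarrow> 'a mat list \<Rightarrow> bool" where
  "codes_mats \<nu> c As \<longleftrightarrow> (\<exists>cs. c = list_encode cs \<and> list_all2 (codes_mat \<nu>) cs As)"

inductive matrix_instance ::
    "(nat \<rightharpoonup> 'a) \<Rightarrow> nat list \<Rightarrow> nat \<times> 'a mat list \<times> 'a mat \<Rightarrow> bool"
  for \<nu> where
  "\<lbrakk>set As \<subseteq> carrier_mat n n; M \<in> carrier_mat n n;
    codes_mats \<nu> c As; codes_mat \<nu> d M\<rbrakk> \<Longrightarrow>
   matrix_instance \<nu> [n, c, d] (n, As, M)"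

inductive vector_instance ::
    "(nat \<rightharpoonup> 'a) \<Rightarrow> nat list \<Rightarrow> nat \<times> 'a mat list \<times> 'a mat \<times> 'a mat \<Rightarrow> bool"
  for \<nu> where
  "\<lbrakk>set As \<subseteq> carrier_mat n n; \<alpha> \<in> carrier_mat 1 n; \<eta> \<in> carrier_mat 1 n;
    codes_mats \<nu> c As; codes_mat \<nu> a \<alpha>; codes_mat \<nu> e \<eta>\<rbrakk> \<Longrightarrow>
   vector_instance \<nu> [n, c, a, e] (n, As, \<alpha>, \<eta>)"

inductive scalar_instance ::
    "(nat \<rightharpoonup> 'a) \<Rightarrow> nat list \<Rightarrow> nat \<times> 'a mat list \<times> 'a mat \<times> 'a mat \<times> 'a \<Rightarrow> bool"
  for \<nu> where
  "\<lbrakk>set As \<subseteq> carrier_mat n n; \<alpha> \<in> carrier_mat 1 n; \<beta> \<in> carrier_mat n 1;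
    codes_mats \<nu> c As; codes_mat \<nu> a \<alpha>; codes_mat \<nu> b \<beta>; \<nu> x = Some \<gamma>\<rbrakk> \<Longrightarrow>
   scalar_instance \<nu> [n, c, a, b, x] (n, As, \<alpha>, \<beta>, \<gamma>)"

end

theory Submission
  imports
    Defs
    "HOL-Library.More_List"
begin

text \<open>
  All three problems ask whether some goal state can be reached from finitely many starting states
  by multiplication with the generators from the right: the states are \<open>n \<times> n\<close> matrices in the
  matrix problem and row vectors in the other two. An element \<open>\<gamma>\<close> is separated from all
  others by its morphism \<open>\<pi> \<gamma>\<close> into a finite semiring. Hence whether a state is a goal depends only
  on the images of its entries under finitely many of these morphisms: those of the entries of the
  target matrix or vector, or the single one that belongs to the target scalar.

  There are finitely many families of such images, say at most \<open>N\<close>, and multiplication by a generator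
  acts on them (\<open>hom_mat_mult_cong\<close>). In a system with at most \<open>N\<close> states whatever can be reached at all
  can be reached in \<open>N\<close> steps (\<open>closure_chain_stabilizes\<close>). So if a goal is reachable, then some goal is
  reachable by multiplying a starting state with at most \<open>N\<close> generators (\<open>search_bound\<close>). The
  algorithm computes \<open>N\<close>, forms all these products in the given semiring itself and tests
  each of them for being a goal with the equality oracle. The finite semirings serve only to compute
  \<open>N\<close>, and any number that is too large does as well. Such a number can be read off their codes
  (\<open>effectively_separated_size_bound\<close>).

  Computability of the algorithm is shown with represented sets. A map is realizable if some recursive
  function carries each code of an argument to a code of the value, and realizable maps are closed
  under composition, primitive recursion and the usual operations on lists and matrices. Upper bounds
  fit into this scheme: a number is a code of every number that it bounds (\<open>upper_rep\<close>), and an argument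
  may be given by such a code if the value stops depending on it once it is large
  (\<open>realizable_upper\<close>).
\<close>

section \<open>Basic recursive functions\<close>

text \<open>
  The introduction rules without the one for oracles, whose conclusion would match every goal.
\<close>

lemmas recursive_intros = partial_recursive_in.intros(2-7)

lemma recursive_add:
  "\<exists>g. partial_recursive_in Orc g \<and> (\<forall>x y. g [x, y] = Some (x + y))"
proof -
  let ?g = "primrec_fn (proj_fn 0) (comp_fn succ_fn [proj_fn 1])"
  have "?g [x, y] = Some (x + y)" for x y
    by (induction x) (simp_all add: primrec_fn_def proj_fn_def comp_fn_def succ_fn_def)
  then show ?thesis
    by (intro exI[of _ ?g]) (auto intro!: recursive_intros)
qed

lemma recursive_pred:
  "\<exists>g. partial_recursive_in Orc g \<and> (\<forall>x. g [x] = Some (x - 1))"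
proof -
  let ?g = "primrec_fn (\<lambda>_. Some 0) (proj_fn 0)"
  have "?g [x] = Some (x - 1)" for x
    by (induction x) (simp_all add: primrec_fn_def proj_fn_def)
  then show ?thesis
    by (intro exI[of _ ?g]) (auto intro!: recursive_intros)
qed

lemma recursive_diff:
  "\<exists>g. partial_recursive_in Orc g \<and> (\<forall>x y. g [x, y] = Some (x - y))"
proof -
  obtain p where p: "partial_recursive_in Orc p" "\<And>x. p [x] = Some (x - 1)"
    using recursive_pred by blast
  let ?g = "primrec_fn (proj_fn 0) (comp_fn p [proj_fn 1])"
  have "?g [y, x] = Some (x - y)" for x y
    by (induction y) (simp_all add: primrec_fn_def proj_fn_def comp_fn_def p)
  then have "comp_fn ?g [proj_fn 1, proj_fn 0] [x, y] = Some (x - y)" for x y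
    by (simp add: comp_fn_def proj_fn_def)
  then show ?thesis
    using p(1)
    by (intro exI[of _ "comp_fn ?g [proj_fn 1, proj_fn 0]"])
      (auto intro!: recursive_intros)
qed

lemma recursive_triangle:
  "\<exists>g. partial_recursive_in Orc g \<and> (\<forall>x. g [x] = Some (triangle x))"
proof -
  obtain a where a: "partial_recursive_in Orc a" "\<And>x y. a [x, y] = Some (x + y)"
    using recursive_add by blast
  let ?g = "primrec_fn (\<lambda>_. Some 0) (comp_fn a [proj_fn 1, comp_fn succ_fn [proj_fn 0]])"
  have "?g [x] = Some (triangle x)" for x
    by (induction x)
      (simp_all add: primrec_fn_def proj_fn_def comp_fn_def succ_fn_def a del: triangle_def)
  then show ?thesis
    using a(1) by (intro exI[of _ ?g]) (auto intro!: recursive_intros)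
qed

lemma recursive_prod_encode:
  "\<exists>g. partial_recursive_in Orc g \<and> (\<forall>x y. g [x, y] = Some (prod_encode (x, y)))"
proof -
  obtain a where a: "partial_recursive_in Orc a" "\<And>x y. a [x, y] = Some (x + y)"
    using recursive_add by blast
  obtain t where t: "partial_recursive_in Orc t" "\<And>x. t [x] = Some (triangle x)"
    using recursive_triangle by blast
  let ?g = "comp_fn a [comp_fn t [a], proj_fn 0]"
  have "?g [x, y] = Some (prod_encode (x, y))" for x y
    by (simp add: proj_fn_def comp_fn_def a t prod_encode_def)
  then show ?thesis
    using a(1) t(1) by (intro exI[of _ ?g]) (auto intro!: recursive_intros)
qed

text \<open>
  The diagonal \<open>k = a + b\<close> on which \<open>z = prod_encode (a, b)\<close> lies is the least \<open>k\<close> with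
  \<open>z < triangle (Suc k)\<close>, so a single unbounded search inverts the pairing function.
\<close>

lemma
  shows recursive_fst: "\<exists>g. partial_recursive_in Orc g \<and> (\<forall>z. g [z] = Some (fst (prod_decode z)))"
    and recursive_snd: "\<exists>g. partial_recursive_in Orc g \<and> (\<forall>z. g [z] = Some (snd (prod_decode z)))"
proof -
  obtain d where d: "partial_recursive_in Orc d" "\<And>x y. d [x, y] = Some (x - y)"
    using recursive_diff by blast
  obtain t where t: "partial_recursive_in Orc t" "\<And>x. t [x] = Some (triangle x)"
    using recursive_triangle by blast
  let ?h = "comp_fn d [comp_fn succ_fn [proj_fn (Suc 0)], comp_fn t [comp_fn succ_fn [proj_fn 0]]]"
  let ?k = "mu_fn ?h"
  let ?fst = "comp_fn d [proj_fn 0, comp_fn t [?k]]"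
  let ?snd = "comp_fn d [?k, ?fst]"
  have h: "?h [k, z] = Some (Suc z - triangle (Suc k))" for k z
    by (simp add: proj_fn_def comp_fn_def succ_fn_def d t del: triangle_Suc)
  have mono: "triangle k \<le> triangle l" if "k \<le> l" for k l
    using that by (induction rule: dec_induct) auto
  have k: "?k [prod_encode (a, b)] = Some (a + b)" for a b
  proof -
    have zero: "?h [k, prod_encode (a, b)] = Some 0 \<longleftrightarrow> a + b \<le> k" for k
    proof (cases "a + b \<le> k")
      case True
      then show ?thesis
        using mono[OF True] by (simp add: h prod_encode_def)
    next
      case False
      then have "triangle (Suc k) \<le> triangle (a + b)"
        by (intro mono) simp
      then show ?thesis
        using False by (simp add: h prod_encode_def del: triangle_Suc)
    qed
    have "(LEAST n. a + b \<le> n) = a + b"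
      by (rule Least_equality) auto
    moreover have "\<exists>n. a + b \<le> n \<and> (\<forall>m<n. ?h [m, prod_encode (a, b)] \<noteq> None)"
      using h by auto
    ultimately show ?thesis
      unfolding mu_fn_def zero by simp
  qed
  have fst: "?fst [prod_encode (a, b)] = Some a" for a b
    by (simp add: comp_fn_def[of d] comp_fn_def[of t] proj_fn_def d t k) (simp add: prod_encode_def)
  have snd: "?snd [prod_encode (a, b)] = Some b" for a b
    by (simp add: comp_fn_def[of d "[_, ?fst]"] k fst d)
  have rec: "partial_recursive_in Orc ?fst" "partial_recursive_in Orc ?snd"
    using d(1) t(1) by (auto intro!: recursive_intros)
  have "?fst [z] = Some (fst (prod_decode z))" "?snd [z] = Some (snd (prod_decode z))" for z
    using fst[of "fst (prod_decode z)" "snd (prod_decode z)"]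
      snd[of "fst (prod_decode z)" "snd (prod_decode z)"] by simp_all
  with rec show "\<exists>g. partial_recursive_in Orc g \<and> (\<forall>z. g [z] = Some (fst (prod_decode z)))"
    "\<exists>g. partial_recursive_in Orc g \<and> (\<forall>z. g [z] = Some (snd (prod_decode z)))"
    by blast+
qed

section \<open>Computable maps between represented sets\<close>

text \<open>
  A representation of a set relates natural numbers to the elements that they code; elements may have
  many codes or none. A map is realizable if some recursive function takes codes of arguments to
  codes of values. It may do anything on numbers that code nothing. Hence partiality of the oracles
  never shows in an algorithm: algorithms are written as total functions on matrices and lists, and
  their computability follows their syntax by closure rules. In such a rule the variable \<open>e\<close> is
  the environment in which a term is evaluated; a rule for a binder extends it to a tuple.
\<close>

definition realizable ::
    "(nat list \<rightharpoonup> nat) set \<Rightarrow> (nat \<Rightarrow> 'a \<Rightarrow> bool) \<Rightarrow> (nat \<Rightarrow> 'b \<Rightarrow> bool) \<Rightarrow> ('a \<Rightarrow> 'b) \<Rightarrow> bool" where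
  "realizable Orc R Q f \<longleftrightarrow>
     (\<exists>g. partial_recursive_in Orc g \<and> (\<forall>x a. R x a \<longrightarrow> (\<exists>y. g [x] = Some y \<and> Q y (f a))))"

definition prod_rep ::
    "(nat \<Rightarrow> 'a \<Rightarrow> bool) \<Rightarrow> (nat \<Rightarrow> 'b \<Rightarrow> bool) \<Rightarrow> nat \<Rightarrow> 'a \<times> 'b \<Rightarrow> bool" (infixr "\<times>\<^sub>r" 80) where
  "(R \<times>\<^sub>r Q) x p \<longleftrightarrow> R (fst (prod_decode x)) (fst p) \<and> Q (snd (prod_decode x)) (snd p)"

definition nat_rep :: "nat \<Rightarrow> nat \<Rightarrow> bool" where
  "nat_rep x n \<longleftrightarrow> x = n"

definition bool_rep :: "nat \<Rightarrow> bool \<Rightarrow> bool" where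
  "bool_rep x b \<longleftrightarrow> x = (if b then 1 else 0)"

text \<open>This extends the coding of lists of matrices to lists over any represented set.\<close>

definition list_rep :: "(nat \<Rightarrow> 'a \<Rightarrow> bool) \<Rightarrow> nat \<Rightarrow> 'a list \<Rightarrow> bool" where
  "list_rep R c xs \<longleftrightarrow> (\<exists>cs. c = list_encode cs \<and> list_all2 R cs xs)"

text \<open>
  Coding a number by any upper bound makes a quantity computable as soon as it can be bounded
  effectively.
\<close>

definition upper_rep :: "nat \<Rightarrow> nat \<Rightarrow> bool" where
  "upper_rep x n \<longleftrightarrow> n \<le> x"

lemma realizable_mono:
  assumes "realizable Orc R Q f"
    and "\<And>x a. R' x a \<Longrightarrow> R x a" and "\<And>x a y. R' x a \<Longrightarrow> Q y (f a) \<Longrightarrow> Q' y (f' a)"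
  shows "realizable Orc R' Q' f'"
  using assms unfolding realizable_def by meson

lemma realizable_id: "realizable Orc R R (\<lambda>e. e)"
proof -
  have "proj_fn 0 [x] = Some x" for x
    by (simp add: proj_fn_def)
  then show ?thesis
    unfolding realizable_def using partial_recursive_in.Proj by blast
qed

lemma realizable_comp:
  assumes "realizable Orc R Q f" "realizable Orc Q P g"
  shows "realizable Orc R P (\<lambda>e. g (f e))"
proof -
  obtain F where F: "partial_recursive_in Orc F" "\<And>x a. R x a \<Longrightarrow> \<exists>y. F [x] = Some y \<and> Q y (f a)"
    using assms(1) unfolding realizable_def by blast
  obtain G where G: "partial_recursive_in Orc G" "\<And>x a. Q x a \<Longrightarrow> \<exists>y. G [x] = Some y \<and> P y (g a)"
    using assms(2) unfolding realizable_def by blast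
  have "\<exists>y. comp_fn G [F] [x] = Some y \<and> P y (g (f a))" if "R x a" for x a
  proof -
    obtain y where "F [x] = Some y" "Q y (f a)"
      using F(2) \<open>R x a\<close> by blast
    then show ?thesis
      using G(2) by (auto simp: comp_fn_def)
  qed
  moreover have "partial_recursive_in Orc (comp_fn G [F])"
    using F(1) G(1) by (auto intro: partial_recursive_in.Comp)
  ultimately show ?thesis
    unfolding realizable_def by blast
qed

lemma realizable_binary:
  assumes "partial_recursive_in Orc h"
    and "\<And>x y a b. Q x a \<Longrightarrow> P y b \<Longrightarrow> \<exists>z. h [x, y] = Some z \<and> T z (k a b)"
    and "realizable Orc R Q f" "realizable Orc R P g"
  shows "realizable Orc R T (\<lambda>e. k (f e) (g e))"
proof -
  obtain F where F: "partial_recursive_in Orc F" "\<And>x a. R x a \<Longrightarrow> \<exists>y. F [x] = Some y \<and> Q y (f a)"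
    using assms(3) unfolding realizable_def by blast
  obtain G where G: "partial_recursive_in Orc G" "\<And>x a. R x a \<Longrightarrow> \<exists>y. G [x] = Some y \<and> P y (g a)"
    using assms(4) unfolding realizable_def by blast
  have "\<exists>y. comp_fn h [F, G] [x] = Some y \<and> T y (k (f a) (g a))" if "R x a" for x a
  proof -
    obtain y where "F [x] = Some y" "Q y (f a)"
      using F(2) \<open>R x a\<close> by blast
    moreover obtain z where "G [x] = Some z" "P z (g a)"
      using G(2) \<open>R x a\<close> by blast
    ultimately show ?thesis
      using assms(2) by (auto simp: comp_fn_def)
  qed
  moreover have "partial_recursive_in Orc (comp_fn h [F, G])"
    using F(1) G(1) assms(1) by (auto intro: partial_recursive_in.Comp)
  ultimately show ?thesis
    unfolding realizable_def by blast
qed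

lemma realizable_unary:
  assumes "partial_recursive_in Orc h"
    and "\<And>x a. Q x a \<Longrightarrow> \<exists>z. h [x] = Some z \<and> P z (k a)"
    and "realizable Orc R Q f"
  shows "realizable Orc R P (\<lambda>e. k (f e))"
  by (rule realizable_comp[OF assms(3)]) (use assms(1,2) in \<open>auto simp: realizable_def\<close>)

lemma realizable_Pair:
  assumes "realizable Orc R Q f" "realizable Orc R P g"
  shows "realizable Orc R (Q \<times>\<^sub>r P) (\<lambda>e. (f e, g e))"
proof -
  obtain h where "partial_recursive_in Orc h" "\<And>x y. h [x, y] = Some (prod_encode (x, y))"
    using recursive_prod_encode by blast
  then show ?thesis
    using realizable_binary[OF _ _ assms, of h "Q \<times>\<^sub>r P" Pair] by (auto simp: prod_rep_def)
qed

lemma realizable_fst: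
  assumes "realizable Orc R (Q \<times>\<^sub>r P) f"
  shows "realizable Orc R Q (\<lambda>e. fst (f e))"
proof -
  obtain h where "partial_recursive_in Orc h" "\<And>z. h [z] = Some (fst (prod_decode z))"
    using recursive_fst by blast
  then show ?thesis
    using realizable_unary[OF _ _ assms, of h Q fst] by (auto simp: prod_rep_def)
qed

lemma realizable_snd:
  assumes "realizable Orc R (Q \<times>\<^sub>r P) f"
  shows "realizable Orc R P (\<lambda>e. snd (f e))"
proof -
  obtain h where "partial_recursive_in Orc h" "\<And>z. h [z] = Some (snd (prod_decode z))"
    using recursive_snd by blast
  then show ?thesis
    using realizable_unary[OF _ _ assms, of h P snd] by (auto simp: prod_rep_def)
qed

lemma realizable_Suc:
  assumes "realizable Orc R nat_rep f"
  shows "realizable Orc R nat_rep (\<lambda>e. Suc (f e))"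
  using realizable_unary[OF partial_recursive_in.Succ _ assms, of nat_rep Suc]
  by (auto simp: nat_rep_def succ_fn_def)

lemma realizable_const:
  assumes "Q y c"
  shows "realizable Orc R Q (\<lambda>_. c)"
proof -
  have "realizable Orc R nat_rep (\<lambda>_. n)" for n
  proof (induction n)
    case 0
    show ?case
      unfolding realizable_def nat_rep_def using partial_recursive_in.Zero by blast
  next
    case (Suc n)
    then show ?case
      by (rule realizable_Suc)
  qed
  from this[of y] show ?thesis
    by (rule realizable_mono) (use assms in \<open>auto simp: nat_rep_def\<close>)
qed

text \<open>
  Every loop of the algorithm reduces to this rule. The environment is passed along unchanged, so
  both the start value and the step may refer to it.
\<close>

lemma realizable_rec_nat:
  assumes n: "realizable Orc R nat_rep n"
    and f: "realizable Orc R Q f"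
    and g: "realizable Orc (nat_rep \<times>\<^sub>r Q \<times>\<^sub>r R) Q (\<lambda>p. g (fst p) (fst (snd p)) (snd (snd p)))"
  shows "realizable Orc R Q (\<lambda>e. rec_nat (f e) (\<lambda>m v. g m v e) (n e))"
proof -
  obtain F where F: "partial_recursive_in Orc F" "\<And>x a. R x a \<Longrightarrow> \<exists>y. F [x] = Some y \<and> Q y (f a)"
    using f unfolding realizable_def by blast
  obtain G where G: "partial_recursive_in Orc G"
      "\<And>x p. (nat_rep \<times>\<^sub>r Q \<times>\<^sub>r R) x p \<Longrightarrow>
        \<exists>y. G [x] = Some y \<and> Q y (g (fst p) (fst (snd p)) (snd (snd p)))"
    using g unfolding realizable_def by blast
  obtain c where c: "partial_recursive_in Orc c" "\<And>x y. c [x, y] = Some (prod_encode (x, y))"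
    using recursive_prod_encode by blast
  let ?G = "comp_fn G [comp_fn c [proj_fn 0, comp_fn c [proj_fn (Suc 0), proj_fn 2]]]"
  let ?h = "primrec_fn F ?G"
  have rec: "partial_recursive_in Orc ?h"
    using F(1) G(1) c(1) by (auto intro!: recursive_intros)
  have G': "?G [m, v, x] = G [prod_encode (m, prod_encode (v, x))]" for m v x
    by (simp add: comp_fn_def proj_fn_def c)
  have h: "\<exists>y. ?h [n, x] = Some y \<and> Q y (rec_nat (f e) (\<lambda>m v. g m v e) n)" if "R x e" for n x e
  proof (induction n)
    case 0
    then show ?case
      using F(2)[OF that] by (simp add: primrec_fn_def)
  next
    case (Suc n)
    then obtain v where v: "?h [n, x] = Some v" "Q v (rec_nat (f e) (\<lambda>m v. g m v e) n)"
      by blast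
    have "?h [Suc n, x] = Option.bind (?h [n, x]) (\<lambda>v. ?G [n, v, x])"
      by (simp add: primrec_fn_def)
    then have "?h [Suc n, x] = G [prod_encode (n, prod_encode (v, x))]"
      using v(1) by (simp add: G')
    moreover have "(nat_rep \<times>\<^sub>r Q \<times>\<^sub>r R) (prod_encode (n, prod_encode (v, x)))
        (n, rec_nat (f e) (\<lambda>m v. g m v e) n, e)"
      using v(2) that by (simp add: prod_rep_def nat_rep_def)
    ultimately show ?case
      using G(2) by fastforce
  qed
  show ?thesis
    by (rule realizable_binary[OF rec _ n realizable_id, where k = "\<lambda>n e. rec_nat (f e) (\<lambda>m v. g m v e) n"])
      (use h in \<open>auto simp: nat_rep_def\<close>)
qed

text \<open>An argument that does not influence the value may be replaced by any effective upper bound.\<close>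

lemma realizable_upper:
  assumes N: "realizable Orc R upper_rep N"
    and f: "realizable Orc (nat_rep \<times>\<^sub>r R) Q (\<lambda>p. f (fst p) (snd p))"
    and "\<And>x e k. R x e \<Longrightarrow> N e \<le> k \<Longrightarrow> f k e = h e"
  shows "realizable Orc R Q h"
proof -
  obtain F where F: "partial_recursive_in Orc F"
      "\<And>x p. (nat_rep \<times>\<^sub>r R) x p \<Longrightarrow> \<exists>y. F [x] = Some y \<and> Q y (f (fst p) (snd p))"
    using f unfolding realizable_def by blast
  obtain G where G: "partial_recursive_in Orc G" "\<And>x e. R x e \<Longrightarrow> \<exists>k. G [x] = Some k \<and> N e \<le> k"
    using N unfolding realizable_def upper_rep_def by blast
  obtain c where c: "partial_recursive_in Orc c" "\<And>x y. c [x, y] = Some (prod_encode (x, y))"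
    using recursive_prod_encode by blast
  let ?h = "comp_fn F [comp_fn c [G, proj_fn 0]]"
  have "\<exists>y. ?h [x] = Some y \<and> Q y (h e)" if "R x e" for x e
  proof -
    obtain k where k: "G [x] = Some k" "N e \<le> k"
      using G(2) \<open>R x e\<close> by blast
    have "(nat_rep \<times>\<^sub>r R) (prod_encode (k, x)) (k, e)"
      using that by (simp add: prod_rep_def nat_rep_def)
    then obtain y where "F [prod_encode (k, x)] = Some y" "Q y (f k e)"
      using F(2) by fastforce
    then show ?thesis
      using k assms(3)[OF that k(2)] by (simp add: comp_fn_def proj_fn_def c)
  qed
  moreover have "partial_recursive_in Orc ?h"
    using F(1) G(1) c(1) by (auto intro!: recursive_intros)
  ultimately show ?thesis
    unfolding realizable_def by blast
qed

section \<open>Numbers, truth values and lists\<close>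

lemmas realizable_proj = realizable_id realizable_fst realizable_snd

lemma realizable_0: "realizable Orc R nat_rep (\<lambda>_. 0)"
  by (rule realizable_const) (simp add: nat_rep_def)

lemma realizable_1: "realizable Orc R nat_rep (\<lambda>_. 1)"
  by (rule realizable_const) (simp add: nat_rep_def)

lemma realizable_add_of_rep:
  assumes "\<And>x y a b. Q x a \<Longrightarrow> Q y b \<Longrightarrow> Q (x + y) (a + b)"
    and "realizable Orc R Q f" "realizable Orc R Q g"
  shows "realizable Orc R Q (\<lambda>e. f e + g e)"
proof -
  obtain h where "partial_recursive_in Orc h" "\<And>x y. h [x, y] = Some (x + y)"
    using recursive_add by blast
  then show ?thesis
    using realizable_binary[OF _ _ assms(2,3), of h Q "(+)"] assms(1) by auto
qed

lemma realizable_add: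
  assumes "realizable Orc R nat_rep f" "realizable Orc R nat_rep g"
  shows "realizable Orc R nat_rep (\<lambda>e. f e + g e)"
  using assms by (rule realizable_add_of_rep[rotated]) (auto simp: nat_rep_def)

lemma realizable_upper_add:
  assumes "realizable Orc R upper_rep f" "realizable Orc R upper_rep g"
  shows "realizable Orc R upper_rep (\<lambda>e. f e + g e)"
  using assms by (rule realizable_add_of_rep[rotated]) (auto simp: upper_rep_def)

lemma realizable_diff:
  assumes "realizable Orc R nat_rep f" "realizable Orc R nat_rep g"
  shows "realizable Orc R nat_rep (\<lambda>e. f e - g e)"
proof -
  obtain h where "partial_recursive_in Orc h" "\<And>x y. h [x, y] = Some (x - y)"
    using recursive_diff by blast
  then show ?thesis
    using realizable_binary[OF _ _ assms, of h nat_rep "(-)"] by (auto simp: nat_rep_def)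
qed

lemma realizable_mult:
  assumes "realizable Orc R nat_rep f" "realizable Orc R nat_rep g"
  shows "realizable Orc R nat_rep (\<lambda>e. f e * g e)"
proof -
  have "realizable Orc R nat_rep (\<lambda>e. rec_nat 0 (\<lambda>_ v. g e + v) (f e))"
    by (rule realizable_rec_nat realizable_add realizable_0 realizable_proj assms
        realizable_comp[OF _ assms(2)])+
  moreover have "rec_nat 0 (\<lambda>_ v. b + v) a = a * b" for a b :: nat
    by (induction a) auto
  ultimately show ?thesis
    by simp
qed

lemma realizable_power_upper:
  assumes "realizable Orc R upper_rep f" "realizable Orc R nat_rep g"
  shows "realizable Orc R upper_rep (\<lambda>e. f e ^ g e)"
proof -
  have pow: "realizable Orc (nat_rep \<times>\<^sub>r nat_rep) nat_rep (\<lambda>p. fst p ^ snd p)"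
  proof -
    have "realizable Orc (nat_rep \<times>\<^sub>r nat_rep) nat_rep
        (\<lambda>p. rec_nat 1 (\<lambda>_ v. fst p * v) (snd p))"
      unfolding One_nat_def
      by (rule realizable_rec_nat realizable_mult realizable_Suc realizable_0 realizable_proj)+
    moreover have "rec_nat 1 (\<lambda>_ v. a * v) b = a ^ b" for a b :: nat
      by (induction b) auto
    ultimately show ?thesis
      by simp
  qed
  then have "realizable Orc (upper_rep \<times>\<^sub>r nat_rep) upper_rep (\<lambda>p. fst p ^ snd p)"
    unfolding realizable_def by (fastforce simp: prod_rep_def nat_rep_def upper_rep_def power_mono)
  from realizable_comp[OF realizable_Pair[OF assms] this] show ?thesis
    by simp
qed

text \<open>
  Composition for functions of several arguments: a binder rule asks for the realizability of its
  body in an extended environment, and these rules reduce this to the realizability of the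
  body as a function of its arguments.
\<close>

lemma realizable_app2:
  assumes "realizable Orc (Q \<times>\<^sub>r P) T (\<lambda>p. k (fst p) (snd p))"
    and "realizable Orc R Q f" "realizable Orc R P g"
  shows "realizable Orc R T (\<lambda>e. k (f e) (g e))"
  using realizable_comp[OF realizable_Pair[OF assms(2,3)] assms(1)] by simp

lemma realizable_app3:
  assumes "realizable Orc (Q \<times>\<^sub>r P \<times>\<^sub>r O') T (\<lambda>p. k (fst p) (fst (snd p)) (snd (snd p)))"
    and "realizable Orc R Q f" "realizable Orc R P g" "realizable Orc R O' h"
  shows "realizable Orc R T (\<lambda>e. k (f e) (g e) (h e))"
  using realizable_comp[OF realizable_Pair[OF assms(2) realizable_Pair[OF assms(3,4)]] assms(1)] by simp

lemma realizable_codewise: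
  assumes "realizable Orc nat_rep nat_rep k" and "\<And>x a. Q x a \<Longrightarrow> P (k x) (f a)"
    and "realizable Orc R Q g"
  shows "realizable Orc R P (\<lambda>e. f (g e))"
  using assms(1,2)
  by (intro realizable_comp[OF assms(3)]) (fastforce simp: realizable_def nat_rep_def)

lemma realizable_prod_decode:
  assumes "realizable Orc R nat_rep f"
  shows "realizable Orc R (nat_rep \<times>\<^sub>r nat_rep) (\<lambda>e. prod_decode (f e))"
  using assms by (rule realizable_mono) (auto simp: prod_rep_def nat_rep_def)

lemma realizable_True: "realizable Orc R bool_rep (\<lambda>_. True)"
  and realizable_False: "realizable Orc R bool_rep (\<lambda>_. False)"
  by (rule realizable_const, simp add: bool_rep_def)+

lemma realizable_If:
  assumes "realizable Orc R bool_rep b" "realizable Orc R Q f" "realizable Orc R Q g"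
  shows "realizable Orc R Q (\<lambda>e. if b e then f e else g e)"
proof -
  have b: "realizable Orc R nat_rep (\<lambda>e. if b e then 1 else 0)"
    using assms(1) by (rule realizable_mono) (auto simp: bool_rep_def nat_rep_def)
  have "realizable Orc R Q (\<lambda>e. rec_nat (g e) (\<lambda>_ _. f e) (if b e then 1 else 0))"
    by (rule realizable_rec_nat b assms realizable_comp[OF _ assms(2)] realizable_proj)+
  moreover have "rec_nat (g e) (\<lambda>_ _. f e) (if b e then 1 else 0) = (if b e then f e else g e)" for e
    by simp
  ultimately show ?thesis
    by simp
qed

lemma realizable_conj:
  assumes "realizable Orc R bool_rep f" "realizable Orc R bool_rep g"
  shows "realizable Orc R bool_rep (\<lambda>e. f e \<and> g e)"
proof -
  have "(\<lambda>e. f e \<and> g e) = (\<lambda>e. if f e then g e else False)"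
    by auto
  with realizable_If[OF assms realizable_False] show ?thesis
    by (simp only:)
qed

lemma realizable_disj:
  assumes "realizable Orc R bool_rep f" "realizable Orc R bool_rep g"
  shows "realizable Orc R bool_rep (\<lambda>e. f e \<or> g e)"
proof -
  have "(\<lambda>e. f e \<or> g e) = (\<lambda>e. if f e then True else g e)"
    by auto
  with realizable_If[OF assms(1) realizable_True assms(2)] show ?thesis
    by (simp only:)
qed

lemma realizable_all_less:
  assumes "realizable Orc R nat_rep n"
    and P: "realizable Orc (nat_rep \<times>\<^sub>r R) bool_rep (\<lambda>p. P (fst p) (snd p))"
  shows "realizable Orc R bool_rep (\<lambda>e. \<forall>i<n e. P i e)"
proof -
  have "realizable Orc R bool_rep (\<lambda>e. rec_nat True (\<lambda>i v. v \<and> P i e) (n e))"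
    by (rule realizable_rec_nat assms(1) realizable_True realizable_conj realizable_app2[OF P]
        realizable_proj)+
  moreover have "rec_nat True (\<lambda>i v. v \<and> P i e) n \<longleftrightarrow> (\<forall>i<n. P i e)" for e n
    by (induction n) (auto simp: less_Suc_eq)
  ultimately show ?thesis
    by simp
qed

lemma list_rep_Nil: "list_rep R 0 []"
  by (auto simp: list_rep_def intro: exI[of _ "[]"])

lemma realizable_Nil: "realizable Orc R (list_rep Q) (\<lambda>_. [])"
  by (rule realizable_const) (rule list_rep_Nil)

lemma realizable_Cons:
  assumes "realizable Orc R Q f" "realizable Orc R (list_rep Q) g"
  shows "realizable Orc R (list_rep Q) (\<lambda>e. f e # g e)"
proof -
  obtain c where c: "partial_recursive_in Orc c" "\<And>x y. c [x, y] = Some (prod_encode (x, y))"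
    using recursive_prod_encode by blast
  have "comp_fn succ_fn [c] [x, list_encode cs] = Some (list_encode (x # cs))" for x cs
    by (simp add: comp_fn_def succ_fn_def c)
  moreover have "partial_recursive_in Orc (comp_fn succ_fn [c])"
    using c(1) by (auto intro!: recursive_intros)
  ultimately show ?thesis
    using realizable_binary[OF _ _ assms, of "comp_fn succ_fn [c]" "list_rep Q" "(#)"]
    by (force simp: list_rep_def simp del: list_encode.simps)
qed

lemma realizable_null:
  assumes "realizable Orc R (list_rep Q) f"
  shows "realizable Orc R bool_rep (\<lambda>e. f e = [])"
proof (rule realizable_codewise[OF _ _ assms])
  show "realizable Orc nat_rep nat_rep (\<lambda>c. Suc 0 - c)"
    by (rule realizable_diff realizable_Suc realizable_0 realizable_proj)+
  show "bool_rep (Suc 0 - c) (xs = [])" if "list_rep Q c xs" for c xs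
    using that by (cases xs) (auto simp: list_rep_def bool_rep_def list_all2_Cons2)
qed

lemma realizable_tl:
  assumes "realizable Orc R (list_rep Q) f"
  shows "realizable Orc R (list_rep Q) (\<lambda>e. tl (f e))"
proof (rule realizable_codewise[OF _ _ assms])
  show "realizable Orc nat_rep nat_rep (\<lambda>c. snd (prod_decode (c - Suc 0)))"
    by (rule realizable_diff realizable_Suc realizable_0 realizable_proj realizable_prod_decode)+
  have "snd (prod_decode 0) = 0"
    by (simp add: prod_decode_def prod_decode_aux.simps)
  then show "list_rep Q (snd (prod_decode (c - Suc 0))) (tl xs)" if "list_rep Q c xs" for c xs
    using that by (cases xs) (auto simp: list_rep_def list_all2_Cons2 intro: exI[of _ "[]"])
qed

text \<open>
  A default value makes the head total. It has to have a code, and so has the default element in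
  the rules below that take lists apart.
\<close>

lemma realizable_hd:
  assumes "realizable Orc R (list_rep Q) f" "Q y d"
  shows "realizable Orc R Q (\<lambda>e. if f e = [] then d else hd (f e))"
proof (rule realizable_codewise[OF _ _ assms(1)])
  show "realizable Orc nat_rep nat_rep (\<lambda>c. rec_nat y (\<lambda>m _. fst (prod_decode m)) c)"
    by (rule realizable_rec_nat realizable_const[of nat_rep y] realizable_proj
        realizable_prod_decode | simp add: nat_rep_def)+
  show "Q (rec_nat y (\<lambda>m _. fst (prod_decode m)) c) (if xs = [] then d else hd xs)"
    if "list_rep Q c xs" for c xs
    using that assms(2) by (cases xs) (auto simp: list_rep_def list_all2_Cons2)
qed

lemma rec_nat_tl: "rec_nat xs (\<lambda>_ v. tl v) n = drop n xs"
  by (induction n) (simp_all add: drop_Suc tl_drop)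

lemma realizable_nth_default:
  assumes "realizable Orc R (list_rep Q) f" "realizable Orc R nat_rep i" "Q y d"
  shows "realizable Orc R Q (\<lambda>e. nth_default d (f e) (i e))"
proof -
  have "realizable Orc R (list_rep Q) (\<lambda>e. rec_nat (f e) (\<lambda>_ v. tl v) (i e))"
    by (rule realizable_rec_nat assms realizable_tl realizable_proj)+
  then have "realizable Orc R (list_rep Q) (\<lambda>e. drop (i e) (f e))"
    by (simp only: rec_nat_tl)
  from realizable_hd[OF this, where d = d, OF assms(3)] show ?thesis
    by (rule realizable_mono) (auto simp: nth_default_def hd_drop_conv_nth split: if_splits)
qed

lemma length_le_list_encode: "length cs \<le> list_encode cs"
  by (induction cs) (auto intro: order_trans[OF _ le_prod_encode_2])

text \<open>
  A fold is an iteration of a total step that does nothing on the empty list, so any upper bound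
  on the length, such as the code of the list, serves as the number of iterations.
\<close>

lemma realizable_foldl:
  assumes xs: "realizable Orc R (list_rep P) xs" and s: "realizable Orc R Q s"
    and f: "realizable Orc (Q \<times>\<^sub>r P \<times>\<^sub>r R) Q (\<lambda>p. f (fst p) (fst (snd p)) (snd (snd p)))"
    and d: "P y d"
  shows "realizable Orc R Q (\<lambda>e. foldl (\<lambda>v x. f v x e) (s e) (xs e))"
proof -
  define step where "step = (\<lambda>p e. (tl (fst p),
    if fst p = [] then snd p else f (snd p) (if fst p = [] then d else hd (fst p)) e))"
  have step: "realizable Orc (nat_rep \<times>\<^sub>r (list_rep P \<times>\<^sub>r Q) \<times>\<^sub>r nat_rep \<times>\<^sub>r R)
      (list_rep P \<times>\<^sub>r Q) (\<lambda>p. step (fst (snd p)) (snd (snd (snd p))))"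
    unfolding step_def
    by (rule realizable_Pair realizable_tl realizable_If realizable_null realizable_app3[OF f]
        realizable_hd[where Q = P, OF _ d] realizable_proj)+
  have iter: "snd (rec_nat (xs, s) (\<lambda>_ v. step v e) k) = foldl (\<lambda>v x. f v x e) s xs"
    if "length xs \<le> k" for xs s e k
  proof -
    have "rec_nat (xs, s) (\<lambda>_ v. step v e) k
        = (drop k xs, foldl (\<lambda>v x. f v x e) s (take k xs))" for k
    proof (induction k)
      case (Suc k)
      show ?case
      proof (cases "k < length xs")
        case True
        then show ?thesis
          using Suc by (simp add: step_def take_Suc_conv_app_nth hd_drop_conv_nth tl_drop drop_Suc)
      next
        case False
        then show ?thesis
          using Suc by (simp add: step_def)
      qed
    qed simp
    with that show ?thesis
      by simp
  qed
  show ?thesis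
  proof (rule realizable_upper)
    show "realizable Orc R upper_rep (\<lambda>e. length (xs e))"
      using xs by (rule realizable_mono)
        (auto simp: list_rep_def upper_rep_def length_le_list_encode dest!: list_all2_lengthD[symmetric])
    show "realizable Orc (nat_rep \<times>\<^sub>r R) Q
        (\<lambda>p. snd (rec_nat (xs (snd p), s (snd p)) (\<lambda>_ v. step v (snd p)) (fst p)))"
      by (rule realizable_snd realizable_rec_nat step realizable_Pair realizable_comp[OF _ xs]
          realizable_comp[OF _ s] realizable_fst realizable_id)+
  qed (rule iter)
qed

lemma realizable_list_ex:
  assumes "realizable Orc R (list_rep Q) xs"
    and P: "realizable Orc (Q \<times>\<^sub>r R) bool_rep (\<lambda>p. P (fst p) (snd p))"
    and "Q y d"
  shows "realizable Orc R bool_rep (\<lambda>e. \<exists>x\<in>set (xs e). P x e)"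
proof -
  have "realizable Orc R bool_rep (\<lambda>e. foldl (\<lambda>v x. v \<or> P x e) False (xs e))"
    by (rule realizable_foldl assms(1,3) realizable_False realizable_disj
        realizable_app2[OF P] realizable_proj)+
  moreover have "foldl (\<lambda>v x. v \<or> P x e) b xs \<longleftrightarrow> b \<or> (\<exists>x\<in>set xs. P x e)" for e b xs
    by (induction xs arbitrary: b) auto
  ultimately show ?thesis
    by simp
qed

text \<open>Elements are added in front, so the recursion produces them from the last to the first.\<close>

lemma realizable_tabulate:
  assumes "realizable Orc R nat_rep n"
    and f: "realizable Orc (nat_rep \<times>\<^sub>r R) Q (\<lambda>p. f (fst p) (snd p))"
  shows "realizable Orc R (list_rep Q) (\<lambda>e. map (\<lambda>i. f i e) [0..<n e])"
proof -
  have nn: "realizable Orc (nat_rep \<times>\<^sub>r list_rep Q \<times>\<^sub>r R) nat_rep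
      (\<lambda>p. n (snd (snd p)) - Suc (fst p))"
    by (rule realizable_diff realizable_comp[OF _ assms(1)] realizable_Suc realizable_proj)+
  have "realizable Orc R (list_rep Q)
      (\<lambda>e. rec_nat [] (\<lambda>k v. f (n e - Suc k) e # v) (n e))"
    by (rule realizable_rec_nat assms(1) realizable_Nil realizable_Cons realizable_app2[OF f]
        nn realizable_proj)+
  moreover have "rec_nat [] (\<lambda>k v. f (m - Suc k) e # v) j = map (\<lambda>i. f i e) [m - j..<m]"
    if "j \<le> m" for e j m
    using that
  proof (induction j)
    case (Suc j)
    then have "[m - Suc j..<m] = (m - Suc j) # [m - j..<m]"
      by (simp add: upt_conv_Cons Suc_diff_Suc)
    with Suc show ?case
      by simp
  qed simp
  ultimately show ?thesis
    by simp
qed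

section \<open>Matrices over a represented semiring\<close>

definition elem_rep :: "(nat \<rightharpoonup> 'a) \<Rightarrow> nat \<Rightarrow> 'a \<Rightarrow> bool" where
  "elem_rep \<nu> x a \<longleftrightarrow> \<nu> x = Some a"

lemma codes_mats_eq_list_rep: "codes_mats \<nu> = list_rep (codes_mat \<nu>)"
  by (intro ext) (simp add: codes_mats_def list_rep_def)

lemma list_all2_list_rep:
  "list_all2 (list_rep R) cs xss \<longleftrightarrow> (\<exists>css. cs = map list_encode css \<and> list_all2 (list_all2 R) css xss)"
proof (induction xss arbitrary: cs)
  case (Cons xs xss)
  show ?case
  proof
    assume "list_all2 (list_rep R) cs (xs # xss)"
    then obtain c cs' where cs: "cs = c # cs'" "list_rep R c xs" "list_all2 (list_rep R) cs' xss"
      by (auto simp: list_all2_Cons2)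
    with Cons.IH obtain css where "cs' = map list_encode css" "list_all2 (list_all2 R) css xss"
      by blast
    moreover obtain zs where "c = list_encode zs" "list_all2 R zs xs"
      using cs(2) by (auto simp: list_rep_def)
    ultimately show "\<exists>css. cs = map list_encode css \<and> list_all2 (list_all2 R) css (xs # xss)"
      using cs(1) by (intro exI[of _ "zs # css"]) simp
  next
    assume "\<exists>css. cs = map list_encode css \<and> list_all2 (list_all2 R) css (xs # xss)"
    then obtain zs css where "cs = list_encode zs # map list_encode css" "list_all2 R zs xs"
      "list_all2 (list_all2 R) css xss"
      by (auto simp: list_all2_Cons2)
    moreover from this have "list_rep R (list_encode zs) xs"
      "list_all2 (list_rep R) (map list_encode css) xss"
      unfolding Cons.IH by (auto simp: list_rep_def)
    ultimately show "list_all2 (list_rep R) cs (xs # xss)"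
      by simp
  qed
qed simp

text \<open>
  The code of a matrix is the code of its list of rows, so the closure rules for lists carry over
  to matrices.
\<close>

lemma codes_mat_iff:
  "codes_mat \<nu> c A \<longleftrightarrow> list_rep (list_rep (elem_rep \<nu>)) c (mat_to_list A)"
proof
  assume "codes_mat \<nu> c A"
  then obtain C where C: "map_mat \<nu> C = map_mat Some A"
    and c: "c = list_encode (map list_encode (mat_to_list C))"
    by (auto simp: codes_mat_def)
  have dim: "dim_row C = dim_row A" "dim_col C = dim_col A"
    using arg_cong[OF C, of dim_row] arg_cong[OF C, of dim_col] by simp_all
  have "\<nu> (C $$ (i, j)) = Some (A $$ (i, j))" if "i < dim_row A" "j < dim_col A" for i j
    using arg_cong[OF C, of "\<lambda>M. M $$ (i, j)"] that dim by simp
  then have "list_all2 (list_all2 (elem_rep \<nu>)) (mat_to_list C) (mat_to_list A)"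
    by (auto simp: mat_to_list_def dim list_all2_conv_all_nth elem_rep_def)
  then show "list_rep (list_rep (elem_rep \<nu>)) c (mat_to_list A)"
    unfolding list_rep_def[of "list_rep _"] list_all2_list_rep c by blast
next
  assume "list_rep (list_rep (elem_rep \<nu>)) c (mat_to_list A)"
  then obtain css where c: "c = list_encode (map list_encode css)"
    and css: "list_all2 (list_all2 (elem_rep \<nu>)) css (mat_to_list A)"
    unfolding list_rep_def[of "list_rep _"] list_all2_list_rep by blast
  define C where "C = mat (dim_row A) (dim_col A) (\<lambda>(i, j). css ! i ! j)"
  have len: "length css = dim_row A" "\<And>i. i < dim_row A \<Longrightarrow> length (css ! i) = dim_col A"
    and entry: "\<And>i j. i < dim_row A \<Longrightarrow> j < dim_col A \<Longrightarrow> \<nu> (css ! i ! j) = Some (A $$ (i, j))"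
    using css by (auto simp: list_all2_conv_all_nth mat_to_list_def elem_rep_def)
  have "mat_to_list C = css"
    by (intro nth_equalityI) (auto simp: mat_to_list_def C_def len intro!: nth_equalityI)
  moreover have "map_mat \<nu> C = map_mat Some A"
    by (rule eq_matI) (auto simp: C_def entry)
  ultimately show "codes_mat \<nu> c A"
    using c by (auto simp: codes_mat_def)
qed

lemma codes_mat_entry:
  assumes "codes_mat \<nu> c A" "i < dim_row A" "j < dim_col A"
  shows "A $$ (i, j) \<in> ran \<nu>"
proof -
  obtain C where C: "map_mat \<nu> C = map_mat Some A"
    using assms(1) by (auto simp: codes_mat_def)
  have dim: "dim_row C = dim_row A" "dim_col C = dim_col A"
    using arg_cong[OF C, of dim_row] arg_cong[OF C, of dim_col] by simp_all
  have "\<nu> (C $$ (i, j)) = Some (A $$ (i, j))"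
    using arg_cong[OF C, of "\<lambda>M. M $$ (i, j)"] assms(2,3) dim by simp
  then show ?thesis
    by (rule ranI)
qed

text \<open>Entries outside the matrix have a default value, which makes access to entries total.\<close>

definition mat_entry :: "'a \<Rightarrow> 'a mat \<Rightarrow> nat \<Rightarrow> nat \<Rightarrow> 'a" where
  "mat_entry z A i j = nth_default z (nth_default [] (mat_to_list A) i) j"

lemma mat_entry_eq:
  assumes "A \<in> carrier_mat m n" "i < m" "j < n"
  shows "mat_entry z A i j = A $$ (i, j)"
  using assms by (auto simp: mat_entry_def nth_default_def mat_to_list_def)

lemma realizable_mat_entry:
  assumes "realizable Orc R (codes_mat \<nu>) A" "realizable Orc R nat_rep i"
    "realizable Orc R nat_rep j" "\<nu> x = Some z"
  shows "realizable Orc R (elem_rep \<nu>) (\<lambda>e. mat_entry z (A e) (i e) (j e))"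
proof -
  have rows: "realizable Orc R (list_rep (list_rep (elem_rep \<nu>))) (\<lambda>e. mat_to_list (A e))"
    using assms(1) by (rule realizable_mono) (auto simp: codes_mat_iff)
  have "elem_rep \<nu> x z"
    using assms(4) by (simp add: elem_rep_def)
  then show ?thesis
    unfolding mat_entry_def
    by - (rule realizable_nth_default rows assms(2,3) list_rep_Nil | assumption)+
qed

lemma realizable_mat:
  assumes "realizable Orc R nat_rep m" "realizable Orc R nat_rep n"
    and h: "realizable Orc (nat_rep \<times>\<^sub>r nat_rep \<times>\<^sub>r R) (elem_rep \<nu>)
      (\<lambda>p. h (fst p) (fst (snd p)) (snd (snd p)))"
  shows "realizable Orc R (codes_mat \<nu>) (\<lambda>e. mat (m e) (n e) (\<lambda>(i, j). h i j e))"
proof -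
  have "realizable Orc R (list_rep (list_rep (elem_rep \<nu>)))
      (\<lambda>e. map (\<lambda>i. map (\<lambda>j. h i j e) [0..<n e]) [0..<m e])"
    by (rule realizable_tabulate assms(1) realizable_comp[OF _ assms(2)] realizable_app3[OF h]
        realizable_proj)+
  moreover have "map (\<lambda>i. map (\<lambda>j. h i j e) [0..<n e]) [0..<m e]
      = mat_to_list (mat (m e) (n e) (\<lambda>(i, j). h i j e))" for e
    by (simp add: mat_to_list_def)
  ultimately show ?thesis
    by (simp add: realizable_def codes_mat_iff)
qed

lemma empty_mat_code: "codes_mat \<nu> 0 (mat 0 0 h)"
  by (simp add: codes_mat_iff mat_to_list_def list_rep_Nil)

lemma realizable_sum_upper:
  assumes "realizable Orc R nat_rep n"
    and "realizable Orc (nat_rep \<times>\<^sub>r R) upper_rep (\<lambda>p. f (fst p) (snd p))"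
  shows "realizable Orc R upper_rep (\<lambda>e. \<Sum>i<n e. f i e)"
proof -
  have zero: "upper_rep 0 0"
    by (simp add: upper_rep_def)
  have "realizable Orc R upper_rep (\<lambda>e. rec_nat 0 (\<lambda>i v. v + f i e) (n e))"
    by (rule realizable_rec_nat assms(1) realizable_const[of upper_rep, OF zero] realizable_upper_add
        realizable_app2[OF assms(2)] realizable_proj)+
  moreover have "rec_nat 0 (\<lambda>i v. v + f i e) k = (\<Sum>i<k. f i e)" for e k
    by (induction k) auto
  ultimately show ?thesis
    by simp
qed

definition mats_over :: "('a, 'm) ring_scheme \<Rightarrow> nat \<Rightarrow> nat \<Rightarrow> 'a mat set" where
  "mats_over R m n = {A \<in> carrier_mat m n. \<forall>i<m. \<forall>j<n. A $$ (i, j) \<in> carrier R}"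

text \<open>Finite sums in the form of a recursion, in which they are computed and compared.\<close>

definition partial_sum :: "('a, 'm) ring_scheme \<Rightarrow> (nat \<Rightarrow> 'a) \<Rightarrow> nat \<Rightarrow> 'a" where
  "partial_sum R f n = rec_nat \<zero>\<^bsub>R\<^esub> (\<lambda>k v. v \<oplus>\<^bsub>R\<^esub> f k) n"

context semiring
begin

lemma partial_sum_eq_finsum:
  assumes "\<And>k. k < n \<Longrightarrow> f k \<in> carrier R"
  shows "partial_sum R f n = (\<Oplus>k\<in>{0..<n}. f k)"
  using assms
proof (induction n)
  case (Suc n)
  have "(\<Oplus>k\<in>{0..<Suc n}. f k) = f n \<oplus> (\<Oplus>k\<in>{0..<n}. f k)"
    using Suc.prems by (subst atLeast0_lessThan_Suc, subst finsum_insert) auto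
  moreover have "(\<Oplus>k\<in>{0..<n}. f k) \<in> carrier R"
    using Suc.prems by (intro finsum_closed) auto
  ultimately show ?case
    using Suc by (simp add: partial_sum_def a_comm)
qed (simp add: partial_sum_def)

lemma partial_sum_closed:
  assumes "\<And>k. k < n \<Longrightarrow> f k \<in> carrier R"
  shows "partial_sum R f n \<in> carrier R"
  using assms by (simp add: partial_sum_eq_finsum)

lemma mat_mult_entry:
  assumes "A \<in> mats_over R m n" "B \<in> mats_over R n p" "i < m" "j < p"
  shows "mat_mult R A B $$ (i, j) = (\<Oplus>k\<in>{0..<n}. A $$ (i, k) \<otimes> B $$ (k, j))"
  using assms by (auto simp: mat_mult_def mats_over_def)

lemma mat_mult_closed:
  assumes "A \<in> mats_over R m n" "B \<in> mats_over R n p"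
  shows "mat_mult R A B \<in> mats_over R m p"
  using assms by (auto simp: mat_mult_def mats_over_def intro!: finsum_closed)

lemma finsum_swap:
  assumes "finite A" "finite B" "\<And>i j. i \<in> A \<Longrightarrow> j \<in> B \<Longrightarrow> f i j \<in> carrier R"
  shows "(\<Oplus>i\<in>A. \<Oplus>j\<in>B. f i j) = (\<Oplus>j\<in>B. \<Oplus>i\<in>A. f i j)"
  using assms(1,3)
proof (induction A rule: finite_induct)
  case empty
  then show ?case
    by (simp add: finsum_zero)
next
  case (insert a A)
  have "(\<Oplus>j\<in>B. \<Oplus>i\<in>insert a A. f i j) = (\<Oplus>j\<in>B. f a j \<oplus> (\<Oplus>i\<in>A. f i j))"
    using insert by (intro finsum_cong') (auto simp: Pi_def)
  also have "\<dots> = (\<Oplus>j\<in>B. f a j) \<oplus> (\<Oplus>j\<in>B. \<Oplus>i\<in>A. f i j)"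
    using insert by (intro finsum_addf) (auto simp: Pi_def)
  finally show ?case
    using insert by (simp add: Pi_def)
qed

lemma mat_mult_assoc:
  assumes A: "A \<in> mats_over R m n" and B: "B \<in> mats_over R n p" and C: "C \<in> mats_over R p q"
  shows "mat_mult R (mat_mult R A B) C = mat_mult R A (mat_mult R B C)"
proof (rule eq_matI)
  have AB: "mat_mult R A B \<in> mats_over R m p" and BC: "mat_mult R B C \<in> mats_over R n q"
    using assms mat_mult_closed by blast+
  then have "mat_mult R (mat_mult R A B) C \<in> mats_over R m q"
    "mat_mult R A (mat_mult R B C) \<in> mats_over R m q"
    using assms mat_mult_closed by blast+
  then show dim: "dim_row (mat_mult R (mat_mult R A B) C) = dim_row (mat_mult R A (mat_mult R B C))"
    "dim_col (mat_mult R (mat_mult R A B) C) = dim_col (mat_mult R A (mat_mult R B C))"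
    by (auto simp: mats_over_def)
  fix i j
  assume "i < dim_row (mat_mult R A (mat_mult R B C))" "j < dim_col (mat_mult R A (mat_mult R B C))"
  then have i: "i < m" and j: "j < q"
    using A C by (auto simp: mats_over_def mat_mult_def)
  have a: "A $$ (i, k) \<in> carrier R" if "k < n" for k
    using A i that by (auto simp: mats_over_def)
  have b: "B $$ (k, l) \<in> carrier R" if "k < n" "l < p" for k l
    using B that by (auto simp: mats_over_def)
  have c: "C $$ (l, j) \<in> carrier R" if "l < p" for l
    using C j that by (auto simp: mats_over_def)
  have "mat_mult R (mat_mult R A B) C $$ (i, j)
      = (\<Oplus>l\<in>{0..<p}. (\<Oplus>k\<in>{0..<n}. A $$ (i, k) \<otimes> B $$ (k, l)) \<otimes> C $$ (l, j))"
    unfolding mat_mult_entry[OF AB C i j]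
    by (intro finsum_cong') (auto simp: mat_mult_entry[OF A B i] a b c intro!: finsum_closed)
  also have "\<dots> = (\<Oplus>l\<in>{0..<p}. \<Oplus>k\<in>{0..<n}. A $$ (i, k) \<otimes> (B $$ (k, l) \<otimes> C $$ (l, j)))"
    by (intro finsum_cong')
      (auto simp: finsum_ldistr a b c m_assoc Pi_def intro!: finsum_closed cong: finsum_cong)
  also have "\<dots> = (\<Oplus>k\<in>{0..<n}. \<Oplus>l\<in>{0..<p}. A $$ (i, k) \<otimes> (B $$ (k, l) \<otimes> C $$ (l, j)))"
    by (intro finsum_swap) (auto simp: a b c)
  also have "\<dots> = (\<Oplus>k\<in>{0..<n}. A $$ (i, k) \<otimes> (\<Oplus>l\<in>{0..<p}. B $$ (k, l) \<otimes> C $$ (l, j)))"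
    by (intro finsum_cong') (auto simp: finsum_rdistr a b c Pi_def intro!: finsum_closed)
  also have "\<dots> = mat_mult R A (mat_mult R B C) $$ (i, j)"
    unfolding mat_mult_entry[OF A BC i j]
    by (intro finsum_cong') (auto simp: mat_mult_entry[OF B C _ j] a b c intro!: finsum_closed)
  finally show "mat_mult R (mat_mult R A B) C $$ (i, j) = mat_mult R A (mat_mult R B C) $$ (i, j)" .
qed

text \<open>
  A morphism determines the image of an entry of a product from the images of the entries of the
  left factor; hence products can be compared in the finite image.
\<close>

lemma hom_mat_mult_cong:
  assumes h: "h \<in> ring_hom R T"
    and X: "X \<in> mats_over R m n" "Y \<in> mats_over R m n" and A: "A \<in> mats_over R n p"
    and eq: "\<And>i k. i < m \<Longrightarrow> k < n \<Longrightarrow> h (X $$ (i, k)) = h (Y $$ (i, k))"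
    and i: "i < m" and j: "j < p"
  shows "h (mat_mult R X A $$ (i, j)) = h (mat_mult R Y A $$ (i, j))"
proof -
  have x: "X $$ (i, k) \<in> carrier R" "Y $$ (i, k) \<in> carrier R" "A $$ (k, j) \<in> carrier R"
    if "k < n" for k
    using that X A i j by (auto simp: mats_over_def)
  have "h (partial_sum R (\<lambda>k. X $$ (i, k) \<otimes> A $$ (k, j)) l)
      = h (partial_sum R (\<lambda>k. Y $$ (i, k) \<otimes> A $$ (k, j)) l)" if "l \<le> n" for l
    using that
  proof (induction l)
    case (Suc l)
    have "partial_sum R (\<lambda>k. Z $$ (i, k) \<otimes> A $$ (k, j)) l \<in> carrier R" if "Z \<in> {X, Y}" for Z
      using that x Suc.prems by (intro partial_sum_closed) auto
    then show ?case
      using Suc x[of l] eq[OF i, of l]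
      by (simp add: partial_sum_def ring_hom_add[OF h] ring_hom_mult[OF h])
  qed (simp add: partial_sum_def)
  from this[of n] show ?thesis
    using x by (simp add: mat_mult_entry[OF X(1) A i j] mat_mult_entry[OF X(2) A i j]
        partial_sum_eq_finsum)
qed

end

section \<open>Bounded search suffices\<close>

text \<open>
  The images of a growing chain of sets of states form an increasing chain in a finite set, and the
  image of each member depends only on the image of the one before it. Such a chain is constant
  as soon as two consecutive members agree, so it is constant from the cardinality of the finite
  set on.
\<close>

lemma closure_chain_stabilizes:
  fixes U :: "nat \<Rightarrow> 'x set" and act :: "'x \<Rightarrow> 'g \<Rightarrow> 'x" and \<phi> :: "'x \<Rightarrow> 'y"
  assumes chain: "\<And>k. U (Suc k) = U k \<union> {act x g | x g. x \<in> U k \<and> g \<in> G}"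
    and image: "\<And>k x. x \<in> U k \<Longrightarrow> \<phi> x \<in> Q" and "finite Q"
    and cong: "\<And>k l x y g. x \<in> U k \<Longrightarrow> y \<in> U l \<Longrightarrow> g \<in> G \<Longrightarrow> \<phi> x = \<phi> y \<Longrightarrow> \<phi> (act x g) = \<phi> (act y g)"
    and k: "card Q \<le> k" and x: "x \<in> U l"
  obtains y where "y \<in> U k" "\<phi> y = \<phi> x"
proof -
  define V where "V = (\<lambda>k. \<phi> ` U k)"
  have sub: "V k \<subseteq> Q" for k
    using image by (auto simp: V_def)
  have mono: "mono V"
    unfolding V_def by (rule incseq_SucI, subst chain) blast
  have stable: "\<forall>n. V n = V (Suc n) \<longrightarrow> V (Suc n) = V (Suc (Suc n))"
  proof (intro allI impI)
    fix n
    assume eq: "V n = V (Suc n)"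
    have "\<phi> (act x g) \<in> V (Suc n)" if "x \<in> U (Suc n)" "g \<in> G" for x g
    proof -
      have "\<phi> x \<in> V n"
        unfolding eq using that(1) by (simp add: V_def)
      then obtain y where y: "y \<in> U n" "\<phi> x = \<phi> y"
        unfolding V_def by (rule imageE)
      then have "\<phi> (act x g) = \<phi> (act y g)"
        by (intro cong[OF that(1) y(1) that(2)])
      moreover have "act y g \<in> U (Suc n)"
        using y(1) that(2) unfolding chain[of n] by blast
      ultimately show ?thesis
        by (simp add: V_def)
    qed
    then have "V (Suc (Suc n)) \<subseteq> V (Suc n)"
      unfolding V_def chain[of "Suc n"] by auto
    with mono show "V (Suc n) = V (Suc (Suc n))"
      by (simp add: monoD subset_antisym)
  qed
  have "finite (range V)"
    using sub \<open>finite Q\<close> by (intro finite_subset[of "range V" "Pow Q"]) auto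
  from finite_mono_remains_stable_implies_strict_prefix[OF this mono stable]
  have "V (card Q) = (\<Union>n. V n)"
    by (rule finite_mono_strict_prefix_implies_finite_fixpoint[OF sub \<open>finite Q\<close>])
  then have "\<phi> x \<in> V (card Q)"
    using x by (auto simp: V_def)
  then have "\<phi> x \<in> V k"
    using monoD[OF mono k] by blast
  then show ?thesis
    using that by (auto simp: V_def)
qed

section \<open>The search procedure\<close>

context represented_semiring
begin

abbreviation oracles :: "(nat list \<rightharpoonup> nat) set" where
  "oracles \<equiv> {add_orc, mult_orc, eq_orc}"

lemma zero_coded: "\<exists>z. \<nu> z = Some \<zero>"
proof -
  have "\<zero> \<in> ran \<nu>"
    using ran_repr by simp
  then show ?thesis
    by (auto simp: ran_def)
qed

lemma realizable_plus:
  assumes "realizable oracles R (elem_rep \<nu>) f" "realizable oracles R (elem_rep \<nu>) g"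
  shows "realizable oracles R (elem_rep \<nu>) (\<lambda>e. f e \<oplus> g e)"
  by (rule realizable_binary[OF _ _ assms, of add_orc])
    (auto intro: partial_recursive_in.Given add_orc simp: elem_rep_def)

lemma realizable_times:
  assumes "realizable oracles R (elem_rep \<nu>) f" "realizable oracles R (elem_rep \<nu>) g"
  shows "realizable oracles R (elem_rep \<nu>) (\<lambda>e. f e \<otimes> g e)"
  by (rule realizable_binary[OF _ _ assms, of mult_orc])
    (auto intro: partial_recursive_in.Given mult_orc simp: elem_rep_def)

lemma realizable_eq:
  assumes "realizable oracles R (elem_rep \<nu>) f" "realizable oracles R (elem_rep \<nu>) g"
  shows "realizable oracles R bool_rep (\<lambda>e. f e = g e)"
  by (rule realizable_binary[OF _ _ assms, of eq_orc])
    (auto intro: partial_recursive_in.Given simp: eq_orc elem_rep_def bool_rep_def)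

text \<open>
  The formats are arguments because they cannot be recovered from the codes: all matrices without
  rows have the same code.
\<close>

definition sized_mult :: "nat \<Rightarrow> nat \<Rightarrow> nat \<Rightarrow> 'a mat \<Rightarrow> 'a mat \<Rightarrow> 'a mat" where
  "sized_mult m n p A B =
     mat m p (\<lambda>(i, j). partial_sum S (\<lambda>k. mat_entry \<zero> A i k \<otimes> mat_entry \<zero> B k j) n)"

lemma sized_mult_eq:
  assumes "A \<in> mats_over S m n" "B \<in> mats_over S n p"
  shows "sized_mult m n p A B = mat_mult S A B"
proof (rule eq_matI)
  fix i j
  assume "i < dim_row (mat_mult S A B)" "j < dim_col (mat_mult S A B)"
  then have ij: "i < m" "j < p"
    using assms by (auto simp: mat_mult_def mats_over_def)
  have carrier: "A \<in> carrier_mat m n" "B \<in> carrier_mat n p"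
    using assms by (auto simp: mats_over_def)
  have entry: "mat_entry \<zero> A i k \<otimes> mat_entry \<zero> B k j = A $$ (i, k) \<otimes> B $$ (k, j)"
      "A $$ (i, k) \<otimes> B $$ (k, j) \<in> carrier S" if "k < n" for k
    using that ij assms mat_entry_eq[OF carrier(1)] mat_entry_eq[OF carrier(2)]
    by (auto simp: mats_over_def)
  have "sized_mult m n p A B $$ (i, j)
      = (\<Oplus>k\<in>{0..<n}. mat_entry \<zero> A i k \<otimes> mat_entry \<zero> B k j)"
    using ij entry by (simp add: sized_mult_def partial_sum_eq_finsum)
  also have "\<dots> = (\<Oplus>k\<in>{0..<n}. A $$ (i, k) \<otimes> B $$ (k, j))"
    using entry by (intro finsum_cong') auto
  finally show "sized_mult m n p A B $$ (i, j) = mat_mult S A B $$ (i, j)"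
    using mat_mult_entry[OF assms ij] by simp
qed (use assms in \<open>auto simp: sized_mult_def mat_mult_def mats_over_def\<close>)

lemma realizable_sized_mult:
  assumes "realizable oracles R nat_rep m" "realizable oracles R nat_rep n"
    "realizable oracles R nat_rep p" "realizable oracles R (codes_mat \<nu>) A"
    "realizable oracles R (codes_mat \<nu>) B"
  shows "realizable oracles R (codes_mat \<nu>) (\<lambda>e. sized_mult (m e) (n e) (p e) (A e) (B e))"
proof -
  obtain z where z: "\<nu> z = Some \<zero>"
    using zero_coded by blast
  then have z': "elem_rep \<nu> z \<zero>"
    by (simp add: elem_rep_def)
  show ?thesis
    unfolding sized_mult_def partial_sum_def
    by (rule realizable_mat realizable_rec_nat assms realizable_comp[OF _ assms(1)]
        realizable_comp[OF _ assms(2)] realizable_comp[OF _ assms(3)]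
        realizable_comp[OF _ assms(4)] realizable_comp[OF _ assms(5)]
        realizable_const[of "elem_rep \<nu>", OF z'] realizable_plus realizable_times
        realizable_mat_entry z realizable_proj)+
qed

text \<open>
  Repetitions are kept in the list of states. They do no harm, and the algorithm needs no equality
  test until it looks for a goal.
\<close>

definition grow :: "nat \<Rightarrow> nat \<Rightarrow> 'a mat list \<Rightarrow> 'a mat list \<Rightarrow> 'a mat list" where
  "grow m n As Xs = foldl (\<lambda>Ys X. foldl (\<lambda>Ys A. sized_mult m n n X A # Ys) Ys As) Xs Xs"

definition reached :: "nat \<Rightarrow> nat \<Rightarrow> 'a mat list \<Rightarrow> 'a mat list \<Rightarrow> nat \<Rightarrow> 'a mat list" where
  "reached m n As Is k = rec_nat Is (\<lambda>_. grow m n As) k"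

lemma set_foldl_Cons: "set (foldl (\<lambda>Ys A. f A # Ys) Ys As) = set Ys \<union> f ` set As"
  by (induction As arbitrary: Ys) auto

lemma set_grow:
  "set (grow m n As Xs) = set Xs \<union> {sized_mult m n n X A | X A. X \<in> set Xs \<and> A \<in> set As}"
proof -
  have "set (foldl (\<lambda>Ys X. foldl (\<lambda>Ys A. sized_mult m n n X A # Ys) Ys As) Ys Zs)
      = set Ys \<union> {sized_mult m n n X A | X A. X \<in> set Zs \<and> A \<in> set As}" for Ys Zs
    by (induction Zs arbitrary: Ys) (auto simp: set_foldl_Cons)
  then show ?thesis
    by (simp add: grow_def)
qed

lemma realizable_reached:
  assumes "realizable oracles R nat_rep m" "realizable oracles R nat_rep n"
    "realizable oracles R (list_rep (codes_mat \<nu>)) As" "realizable oracles R (list_rep (codes_mat \<nu>)) Is"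
    "realizable oracles R nat_rep k"
  shows "realizable oracles R (list_rep (codes_mat \<nu>)) (\<lambda>e. reached (m e) (n e) (As e) (Is e) (k e))"
  unfolding reached_def grow_def
  by (rule realizable_rec_nat realizable_foldl assms realizable_comp[OF _ assms(1)]
      realizable_comp[OF _ assms(2)] realizable_comp[OF _ assms(3)] realizable_Cons
      realizable_sized_mult empty_mat_code realizable_proj)+

context
  fixes F :: "'a \<Rightarrow> nat ring" and \<pi> :: "'a \<Rightarrow> 'a \<Rightarrow> nat"
  assumes separates: "\<And>\<gamma>. \<gamma> \<in> carrier S \<Longrightarrow> separates S \<gamma> (F \<gamma>) (\<pi> \<gamma>)"
    and size_bound: "realizable oracles (elem_rep \<nu>) upper_rep (\<lambda>\<gamma>. card (carrier (F \<gamma>)))"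
begin

lemma separating_hom: "\<gamma> \<in> carrier S \<Longrightarrow> \<pi> \<gamma> \<in> ring_hom S (F \<gamma>)"
  using separates by (auto simp: separates_def semiring_hom_def)

lemma separating_eq:
  assumes "\<gamma> \<in> carrier S" "a \<in> carrier S" "\<pi> \<gamma> a = \<pi> \<gamma> \<gamma>"
  shows "a = \<gamma>"
  using separates[OF assms(1)] assms(2,3) by (auto simp: separates_def)

text \<open>
  Whether a state \<open>X\<close> is a goal is assumed to depend only on the images of its entries under the
  morphisms that separate the entries of \<open>T\<close>. These images form a family indexed by pairs of
  an entry of \<open>T\<close> and an entry of \<open>X\<close>, and the number of all such families bounds the search.
\<close>

lemma search_bound:
  assumes As: "set As \<subseteq> mats_over S n n" and Is: "set Is \<subseteq> mats_over S m n"
    and T: "T \<in> mats_over S r s"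
    and goal: "\<And>X Y. X \<in> mats_over S m n \<Longrightarrow> Y \<in> mats_over S m n \<Longrightarrow> goal X \<Longrightarrow>
      (\<And>a b i j. a < r \<Longrightarrow> b < s \<Longrightarrow> i < m \<Longrightarrow> j < n \<Longrightarrow>
        \<pi> (T $$ (a, b)) (X $$ (i, j)) = \<pi> (T $$ (a, b)) (Y $$ (i, j))) \<Longrightarrow> goal Y"
    and k: "(\<Sum>a<r. \<Sum>b<s. card (carrier (F (mat_entry \<zero> T a b)))) ^ (r * s * m * n) \<le> k"
  shows "(\<exists>X\<in>set (reached m n As Is k). goal X) \<longleftrightarrow> (\<exists>l. \<exists>X\<in>set (reached m n As Is l). goal X)"
proof
  let ?U = "\<lambda>k. set (reached m n As Is k)"
  let ?I = "{..<r} \<times> {..<s} \<times> {..<m} \<times> {..<n}"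
  \<comment> \<open>\<open>\<phi> X\<close> collects the images of the entries of \<open>X\<close>; its values lie in \<open>PiE ?I C\<close>, which is finite.\<close>
  define \<phi> where "\<phi> = (\<lambda>X. restrict (\<lambda>(a, b, i, j). \<pi> (T $$ (a, b)) (X $$ (i, j))) ?I)"
  define C where "C = (\<lambda>(a, b, i :: nat, j :: nat). carrier (F (T $$ (a, b))))"
  have T_entry: "T $$ (a, b) \<in> carrier S" "mat_entry \<zero> T a b = T $$ (a, b)" if "a < r" "b < s" for a b
    using that T mat_entry_eq[of T r s a b] by (auto simp: mats_over_def)
  have chain: "?U (Suc k) = ?U k \<union> {sized_mult m n n X A | X A. X \<in> ?U k \<and> A \<in> set As}" for k
    by (simp add: reached_def set_grow)
  have closed: "?U k \<subseteq> mats_over S m n" for k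
  proof (induction k)
    case 0
    then show ?case
      using Is by (simp add: reached_def)
  next
    case (Suc k)
    have "sized_mult m n n X A \<in> mats_over S m n" if "X \<in> ?U k" "A \<in> set As" for X A
    proof -
      have "X \<in> mats_over S m n" "A \<in> mats_over S n n"
        using that Suc As by auto
      then show ?thesis
        by (simp add: sized_mult_eq mat_mult_closed)
    qed
    then show ?case
      using Suc by (auto simp: chain)
  qed
  have \<phi>_eq: "\<phi> X = \<phi> Y \<longleftrightarrow> (\<forall>a<r. \<forall>b<s. \<forall>i<m. \<forall>j<n.
      \<pi> (T $$ (a, b)) (X $$ (i, j)) = \<pi> (T $$ (a, b)) (Y $$ (i, j)))" for X Y
    unfolding \<phi>_def by (auto simp: restrict_def fun_eq_iff)
  have image: "\<phi> X \<in> PiE ?I C" if "X \<in> ?U k" for X k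
  proof -
    have X: "X \<in> mats_over S m n"
      using closed that by blast
    have "\<pi> (T $$ (a, b)) (X $$ (i, j)) \<in> carrier (F (T $$ (a, b)))"
      if "a < r" "b < s" "i < m" "j < n" for a b i j
      using that X ring_hom_closed[OF separating_hom[OF T_entry(1)]]
      by (auto simp: mats_over_def)
    then show ?thesis
      by (auto simp: \<phi>_def C_def)
  qed
  have fin: "finite (carrier (F (T $$ (a, b))))" if "a < r" "b < s" for a b
    using separates[OF T_entry(1)[OF that]] by (simp add: separates_def)
  have cong: "\<phi> (sized_mult m n n X A) = \<phi> (sized_mult m n n Y A)"
    if "X \<in> ?U k" "Y \<in> ?U l" "A \<in> set As" "\<phi> X = \<phi> Y" for k l X Y A
  proof -
    have over: "X \<in> mats_over S m n" "Y \<in> mats_over S m n" "A \<in> mats_over S n n"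
      using that closed As by blast+
    then have "\<pi> (T $$ (a, b)) (mat_mult S X A $$ (i, j)) = \<pi> (T $$ (a, b)) (mat_mult S Y A $$ (i, j))"
      if "a < r" "b < s" "i < m" "j < n" for a b i j
      using that \<open>\<phi> X = \<phi> Y\<close> unfolding \<phi>_eq
      by (intro hom_mat_mult_cong[OF separating_hom[OF T_entry(1)], where m = m and n = n and p = n]) auto
    then show ?thesis
      using over by (simp add: \<phi>_eq sized_mult_eq)
  qed
  have "card (PiE ?I C) = (\<Prod>p\<in>?I. card (C p))"
    by (rule card_PiE) auto
  \<comment> \<open>Each factor is a summand of the base of the power.\<close>
  also have "\<dots> \<le> (\<Sum>a<r. \<Sum>b<s. card (carrier (F (mat_entry \<zero> T a b)))) ^ card ?I"
  proof (cases "?I = {}")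
    case False
    have "card (carrier (F (T $$ (a, b)))) \<le> (\<Sum>a<r. \<Sum>b<s. card (carrier (F (mat_entry \<zero> T a b))))"
      if "a < r" "b < s" for a b
    proof -
      have "card (carrier (F (mat_entry \<zero> T a b))) \<le> (\<Sum>b<s. card (carrier (F (mat_entry \<zero> T a b))))"
        using that by (intro member_le_sum) auto
      also have "\<dots> \<le> (\<Sum>a<r. \<Sum>b<s. card (carrier (F (mat_entry \<zero> T a b))))"
        using that by (intro member_le_sum[where f = "\<lambda>a. \<Sum>b<s. card (carrier (F (mat_entry \<zero> T a b)))"]) auto
      finally show ?thesis
        using T_entry(2)[OF that] by simp
    qed
    then have "(\<Prod>p\<in>?I. card (C p)) \<le> (\<Prod>p\<in>?I. \<Sum>a<r. \<Sum>b<s. card (carrier (F (mat_entry \<zero> T a b))))"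
      by (intro prod_mono) (auto simp: C_def)
    then show ?thesis
      by simp
  qed (simp only: prod.empty card.empty power_0)
  also have "\<dots> \<le> k"
    using k by (simp add: card_cartesian_product mult.assoc)
  finally have card: "card (PiE ?I C) \<le> k" .
  show "\<exists>X\<in>?U k. goal X" if ex: "\<exists>l. \<exists>X\<in>?U l. goal X"
  proof -
    obtain l X where X: "X \<in> ?U l" "goal X"
      using ex by blast
    have finite_images: "finite (PiE ?I C)"
      using fin by (intro finite_PiE) (auto simp: C_def)
    obtain Y where Y: "Y \<in> ?U k" "\<phi> Y = \<phi> X"
      by (rule closure_chain_stabilizes[where U = ?U and act = "sized_mult m n n" and G = "set As"
            and \<phi> = \<phi> and Q = "PiE ?I C" and k = k and x = X and l = l])
        (rule chain image finite_images cong card X(1) | assumption)+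
    then have "goal Y"
      using goal[of X Y] closed X unfolding \<phi>_eq by fastforce
    with Y show ?thesis
      by blast
  qed
qed blast

text \<open>
  The number of rounds of the search enters only through an upper bound, so it is enough that the
  cardinalities of the separating semirings are effectively bounded.
\<close>

lemma realizable_search:
  assumes m: "realizable oracles R nat_rep m" and n: "realizable oracles R nat_rep n"
    and r: "realizable oracles R nat_rep r" and s: "realizable oracles R nat_rep s"
    and As: "realizable oracles R (list_rep (codes_mat \<nu>)) As"
    and Is: "realizable oracles R (list_rep (codes_mat \<nu>)) Is"
    and T: "realizable oracles R (codes_mat \<nu>) T"
    and goal: "realizable oracles (codes_mat \<nu> \<times>\<^sub>r R) bool_rep (\<lambda>p. goal (fst p) (snd p))"
    and over: "\<And>x e. R x e \<Longrightarrow> set (As e) \<subseteq> mats_over S (n e) (n e)"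
      "\<And>x e. R x e \<Longrightarrow> set (Is e) \<subseteq> mats_over S (m e) (n e)"
      "\<And>x e. R x e \<Longrightarrow> T e \<in> mats_over S (r e) (s e)"
    and goal_cong: "\<And>x e X Y. R x e \<Longrightarrow> X \<in> mats_over S (m e) (n e) \<Longrightarrow>
      Y \<in> mats_over S (m e) (n e) \<Longrightarrow> goal X e \<Longrightarrow>
      (\<And>a b i j. a < r e \<Longrightarrow> b < s e \<Longrightarrow> i < m e \<Longrightarrow> j < n e \<Longrightarrow>
        \<pi> (T e $$ (a, b)) (X $$ (i, j)) = \<pi> (T e $$ (a, b)) (Y $$ (i, j))) \<Longrightarrow> goal Y e"
  shows "realizable oracles R bool_rep
    (\<lambda>e. \<exists>l. \<exists>X\<in>set (reached (m e) (n e) (As e) (Is e) l). goal X e)"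
proof (rule realizable_upper)
  obtain z where z: "\<nu> z = Some \<zero>"
    using zero_coded by blast
  show "realizable oracles R upper_rep
      (\<lambda>e. (\<Sum>a<r e. \<Sum>b<s e. card (carrier (F (mat_entry \<zero> (T e) a b)))) ^ (r e * s e * m e * n e))"
    by (rule realizable_power_upper realizable_sum_upper realizable_mult assms(1-4)
        realizable_comp[OF _ size_bound] realizable_mat_entry realizable_comp[OF _ T]
        realizable_comp[OF _ s] z realizable_proj)+
  show "realizable oracles (nat_rep \<times>\<^sub>r R) bool_rep
      (\<lambda>p. \<exists>X\<in>set (reached (m (snd p)) (n (snd p)) (As (snd p)) (Is (snd p)) (fst p)). goal X (snd p))"
    by (rule realizable_list_ex realizable_reached realizable_comp[OF _ m] realizable_comp[OF _ n]
        realizable_comp[OF _ As] realizable_comp[OF _ Is] realizable_app2[OF goal] empty_mat_code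
        realizable_proj)+
next
  fix x e k
  assume R: "R x e" and "(\<Sum>a<r e. \<Sum>b<s e. card (carrier (F (mat_entry \<zero> (T e) a b))))
    ^ (r e * s e * m e * n e) \<le> k"
  then show "(\<exists>X\<in>set (reached (m e) (n e) (As e) (Is e) k). goal X e)
      \<longleftrightarrow> (\<exists>l. \<exists>X\<in>set (reached (m e) (n e) (As e) (Is e) l). goal X e)"
    using over[OF R] goal_cong[OF R] by (intro search_bound[where r = "r e" and s = "s e" and T = "T e"]) blast+
qed

end

text \<open>
  In the matrix problem \<open>P w\<close> is the product of the word \<open>w\<close>; in the vector and scalar problems it is
  the given row vector times this product. The starting states belong to the words of length one,
  since the empty word does not count.
\<close>

lemma ex_reached_iff_word:
  assumes As: "set As \<subseteq> mats_over S n n" and Is: "set Is \<subseteq> mats_over S m n"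
    and single: "set Is = (\<lambda>i. P [i]) ` {..<length As}"
    and snoc: "\<And>w i. w \<in> words (length As) \<Longrightarrow> i < length As \<Longrightarrow>
      P (w @ [i]) = mat_mult S (P w) (As ! i)"
  shows "(\<exists>l. \<exists>X\<in>set (reached m n As Is l). goal X) \<longleftrightarrow> (\<exists>w\<in>words (length As). goal (P w))"
proof -
  let ?U = "\<lambda>l. set (reached m n As Is l)" and ?W = "words (length As)"
  have U_0: "?U 0 = set Is"
    by (simp add: reached_def)
  have U_Suc: "?U (Suc l) = ?U l \<union> {sized_mult m n n X A | X A. X \<in> ?U l \<and> A \<in> set As}" for l
    by (simp add: reached_def set_grow)
  have word: "P w \<in> mats_over S m n \<and> (\<exists>l. P w \<in> ?U l)" if "w \<in> ?W" for w
    using that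
  proof (induction w rule: rev_induct)
    case (snoc i w)
    then have i: "i < length As"
      by (auto simp: words_def)
    show ?case
    proof (cases "w = []")
      case True
      then have "P (w @ [i]) \<in> set Is"
        using i single by simp
      then show ?thesis
        using Is U_0 by blast
    next
      case False
      then have w: "w \<in> ?W"
        using snoc.prems by (auto simp: words_def)
      then obtain l where l: "P w \<in> ?U l" "P w \<in> mats_over S m n"
        using snoc.IH by blast
      have A: "As ! i \<in> set As" "As ! i \<in> mats_over S n n"
        using i As by auto
      have P: "P (w @ [i]) = mat_mult S (P w) (As ! i)"
        using assms(4)[OF w i] .
      moreover have "P (w @ [i]) = sized_mult m n n (P w) (As ! i)"
        using sized_mult_eq[OF l(2) A(2)] P by simp
      then have "P (w @ [i]) \<in> ?U (Suc l)"
        unfolding U_Suc using l(1) A(1) by blast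
      ultimately show ?thesis
        using mat_mult_closed[OF l(2) A(2)] by auto
    qed
  qed (simp add: words_def)
  have "\<exists>w\<in>?W. X = P w" if "X \<in> ?U l" for X l
    using that
  proof (induction l arbitrary: X)
    case 0
    then obtain i where "i < length As" "X = P [i]"
      using U_0 single by auto
    then show ?case
      by (intro bexI[of _ "[i]"]) (auto simp: words_def)
  next
    case (Suc l)
    then consider "X \<in> ?U l" | Y A where "X = sized_mult m n n Y A" "Y \<in> ?U l" "A \<in> set As"
      unfolding U_Suc by blast
    then show ?case
    proof cases
      case 2
      then obtain w where w: "w \<in> ?W" "Y = P w"
        using Suc.IH by blast
      obtain i where i: "i < length As" "A = As ! i"
        using 2(3) by (auto simp: in_set_conv_nth)
      have "A \<in> mats_over S n n"
        using 2(3) As by blast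
      then have "X = mat_mult S (P w) (As ! i)"
        using word[OF w(1)] unfolding 2(1) w(2) i(2) by (simp add: sized_mult_eq)
      then have "X = P (w @ [i])"
        using assms(4)[OF w(1) i(1)] by simp
      moreover have "w @ [i] \<in> ?W"
        using w(1) i(1) by (auto simp: words_def)
      ultimately show ?thesis
        by blast
    qed (rule Suc.IH)
  qed
  with word show ?thesis
    by blast
qed

lemma word_prod_singleton: "word_prod S As [i] = As ! i"
  by (simp add: word_prod_def)

lemma word_prod_snoc:
  assumes "w \<in> words r"
  shows "word_prod S As (w @ [i]) = mat_mult S (word_prod S As w) (As ! i)"
  using assms by (simp add: word_prod_def words_def)

lemma word_prod_closed:
  assumes "set As \<subseteq> mats_over S n n" "w \<in> words (length As)"
  shows "word_prod S As w \<in> mats_over S n n"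
  using assms(2)
proof (induction w rule: rev_induct)
  case (snoc i w)
  then have A: "As ! i \<in> mats_over S n n"
    using assms(1) by (auto simp: words_def)
  show ?case
  proof (cases "w = []")
    case False
    then have "w \<in> words (length As)"
      using snoc.prems by (auto simp: words_def)
    then show ?thesis
      using snoc.IH A by (auto simp: word_prod_snoc intro: mat_mult_closed)
  qed (simp add: word_prod_singleton A)
qed (simp add: words_def)

lemma mats_over_if_coded:
  assumes "codes_mat \<nu> c A" "A \<in> carrier_mat m n"
  shows "A \<in> mats_over S m n"
  using assms codes_mat_entry[OF assms(1)] ran_repr by (auto simp: mats_over_def)

lemma mem_mats_over_if_coded:
  assumes "list_rep (codes_mat \<nu>) c As" "set As \<subseteq> carrier_mat m n" "A \<in> set As"
  shows "A \<in> mats_over S m n"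
  using assms mats_over_if_coded
  by (fastforce simp: list_rep_def list_all2_conv_all_nth in_set_conv_nth)

definition entries_agree :: "nat \<Rightarrow> nat \<Rightarrow> 'a mat \<Rightarrow> 'a mat \<Rightarrow> bool" where
  "entries_agree m n A B \<longleftrightarrow> (\<forall>i<m. \<forall>j<n. mat_entry \<zero> A i j = mat_entry \<zero> B i j)"

lemma entries_agree_iff:
  assumes "A \<in> mats_over S m n" "B \<in> mats_over S m n"
  shows "entries_agree m n A B \<longleftrightarrow> A = B"
proof -
  have *: "A \<in> carrier_mat m n" "B \<in> carrier_mat m n"
    using assms by (auto simp: mats_over_def)
  then show ?thesis
    unfolding entries_agree_def
    by (auto simp: mat_entry_eq[OF *(1)] mat_entry_eq[OF *(2)] intro!: eq_matI)
qed

lemma realizable_entries_agree: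
  assumes "realizable oracles R nat_rep m" "realizable oracles R nat_rep n"
    "realizable oracles R (codes_mat \<nu>) A" "realizable oracles R (codes_mat \<nu>) B"
  shows "realizable oracles R bool_rep (\<lambda>e. entries_agree (m e) (n e) (A e) (B e))"
proof -
  obtain z where z: "\<nu> z = Some \<zero>"
    using zero_coded by blast
  show ?thesis
    unfolding entries_agree_def
    by (rule realizable_all_less realizable_eq realizable_mat_entry assms(1) z
        realizable_comp[OF _ assms(2)] realizable_comp[OF _ assms(3)] realizable_comp[OF _ assms(4)]
        realizable_proj)+
qed

text \<open>The starting states of a vector or scalar reachability problem.\<close>

definition row_times :: "nat \<Rightarrow> 'a mat \<Rightarrow> 'a mat list \<Rightarrow> 'a mat list" where
  "row_times n v As = foldl (\<lambda>Ys A. sized_mult 1 n n v A # Ys) [] As"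

lemma realizable_row_times:
  assumes "realizable oracles R nat_rep n" "realizable oracles R (codes_mat \<nu>) v"
    "realizable oracles R (list_rep (codes_mat \<nu>)) As"
  shows "realizable oracles R (list_rep (codes_mat \<nu>)) (\<lambda>e. row_times (n e) (v e) (As e))"
  unfolding row_times_def
  by (rule realizable_foldl assms(3) realizable_Nil realizable_Cons realizable_sized_mult realizable_1
      realizable_comp[OF _ assms(1)] realizable_comp[OF _ assms(2)] empty_mat_code realizable_proj)+

lemma set_row_times:
  assumes "v \<in> mats_over S 1 n" "set As \<subseteq> mats_over S n n"
  shows "set (row_times n v As) = mat_mult S v ` set As"
  unfolding row_times_def set_foldl_Cons
  using assms by (auto simp: sized_mult_eq subset_iff image_iff)

lemma ex_reached_row_times_iff_word:
  assumes v: "v \<in> mats_over S 1 n" and As: "set As \<subseteq> mats_over S n n"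
  shows "(\<exists>l. \<exists>X\<in>set (reached 1 n As (row_times n v As) l). goal X) \<longleftrightarrow>
    (\<exists>w\<in>words (length As). goal (mat_mult S v (word_prod S As w)))"
proof (rule ex_reached_iff_word[OF As])
  show "set (row_times n v As) \<subseteq> mats_over S 1 n"
    using mat_mult_closed[OF v] As by (auto simp: set_row_times[OF v As])
  show "set (row_times n v As) = (\<lambda>i. mat_mult S v (word_prod S As [i])) ` {..<length As}"
    by (auto simp: set_row_times[OF v As] word_prod_singleton in_set_conv_nth intro!: imageI)
  show "mat_mult S v (word_prod S As (w @ [i])) = mat_mult S (mat_mult S v (word_prod S As w)) (As ! i)"
    if "w \<in> words (length As)" "i < length As" for w i
  proof -
    have "As ! i \<in> mats_over S n n"
      using that(2) As by auto
    then show ?thesis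
      using mat_mult_assoc[OF v word_prod_closed[OF As that(1)]] that(1) by (simp add: word_prod_snoc)
  qed
qed

end

section \<open>Decidability of the reachability problems\<close>

text \<open>
  Instances carry format conditions. Making them part of the representation means that an algorithm
  has to be correct on well-formed instances only.
\<close>

definition restrict_rep :: "(nat \<Rightarrow> 'a \<Rightarrow> bool) \<Rightarrow> ('a \<Rightarrow> bool) \<Rightarrow> nat \<Rightarrow> 'a \<Rightarrow> bool" where
  "restrict_rep R D x e \<longleftrightarrow> R x e \<and> D e"

lemma realizable_restrict: "realizable Orc (restrict_rep R D) R (\<lambda>e. e)"
  by (rule realizable_mono[OF realizable_id]) (auto simp: restrict_rep_def)

text \<open>An argument list is coded like the right-nested tuple that the instance is.\<close>

fun args_code :: "nat list \<Rightarrow> nat" where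
  "args_code [] = 0"
| "args_code [x] = x"
| "args_code (x # y # ys) = prod_encode (x, args_code (y # ys))"

lemma recursive_args_code:
  "\<exists>g. partial_recursive_in Orc g \<and>
    (\<forall>xs. length xs = i + Suc k \<longrightarrow> g xs = Some (args_code (drop i xs)))"
proof (induction k arbitrary: i)
  case 0
  have "proj_fn i xs = Some (args_code (drop i xs))" if "length xs = i + Suc 0" for xs
    using that Cons_nth_drop_Suc[of i xs] by (simp add: proj_fn_def flip: Cons_nth_drop_Suc)
  then show ?case
    using partial_recursive_in.Proj by blast
next
  case (Suc k)
  obtain g where g: "partial_recursive_in Orc g"
      "\<And>xs. length xs = Suc i + Suc k \<Longrightarrow> g xs = Some (args_code (drop (Suc i) xs))"
    using Suc[of "Suc i"] by blast
  obtain c where c: "partial_recursive_in Orc c" "\<And>x y. c [x, y] = Some (prod_encode (x, y))"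
    using recursive_prod_encode by blast
  have "comp_fn c [proj_fn i, g] xs = Some (args_code (drop i xs))"
    if "length xs = i + Suc (Suc k)" for xs
  proof -
    have "drop i xs = xs ! i # xs ! Suc i # drop (Suc (Suc i)) xs"
      "drop (Suc i) xs = xs ! Suc i # drop (Suc (Suc i)) xs"
      using that by (simp_all add: Cons_nth_drop_Suc)
    then show ?thesis
      using that g(2)[of xs] by (simp add: comp_fn_def proj_fn_def c)
  qed
  moreover have "partial_recursive_in Orc (comp_fn c [proj_fn i, g])"
    using c(1) g(1) by (auto intro!: recursive_intros)
  ultimately show ?case
    by blast
qed

lemma decidable_in_if_realizable:
  assumes "realizable Orc R bool_rep P"
    and codes: "\<And>xs i. codes xs i \<Longrightarrow> length xs = Suc k \<and> R (args_code xs) i"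
  shows "decidable_in Orc codes P"
proof -
  obtain F where F: "partial_recursive_in Orc F"
      "\<And>x i. R x i \<Longrightarrow> \<exists>y. F [x] = Some y \<and> bool_rep y (P i)"
    using assms(1) unfolding realizable_def by blast
  obtain g where g: "partial_recursive_in Orc g" "\<And>xs. length xs = Suc k \<Longrightarrow> g xs = Some (args_code xs)"
    using recursive_args_code[of Orc 0 k] by auto
  have "comp_fn F [g] xs = Some (if P i then 1 else 0)" if "codes xs i" for xs i
    using codes[OF that] F(2)[of "args_code xs" i] g(2)[of xs] by (auto simp: comp_fn_def bool_rep_def)
  moreover have "partial_recursive_in Orc (comp_fn F [g])"
    using F(1) g(1) by (auto intro!: recursive_intros)
  ultimately show ?thesis
    unfolding decidable_in_def by blast
qed

lemma card_le_set_encode: "finite C \<Longrightarrow> card C \<le> set_encode C"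
  by (simp add: set_encode_def card_eq_sum sum_mono del: sum_constant)

lemma card_le_finite_semiring_code:
  assumes "finite (carrier T)"
  shows "card (carrier T) \<le> finite_semiring_code T"
proof -
  have "x \<le> list_encode (x # xs)" for x xs
    using le_prod_encode_1[of x "list_encode xs"] by simp
  then have "set_encode (carrier T) \<le> finite_semiring_code T"
    by (simp only: finite_semiring_code_def)
  with card_le_set_encode[OF assms] show ?thesis
    by simp
qed

text \<open>
  The code of a finite semiring is at least as large as the code of its set of elements, hence at
  least as large as the number of its elements. Renaming the elements does not change this number.
  So the function that computes the separating semirings also bounds their size.
\<close>

lemma effectively_separated_size_bound:
  fixes S :: "('a, 'm) ring_scheme"
  assumes "effectively_separated S \<nu> Orc"
  shows "\<exists>(F :: 'a \<Rightarrow> nat ring) \<pi>. (\<forall>\<gamma>\<in>carrier S. separates S \<gamma> (F \<gamma>) (\<pi> \<gamma>)) \<and>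
    realizable Orc (elem_rep \<nu>) upper_rep (\<lambda>\<gamma>. card (carrier (F \<gamma>)))"
proof -
  obtain F :: "'a \<Rightarrow> nat ring" and \<pi> p q where sep: "\<forall>\<gamma>\<in>carrier S. separates S \<gamma> (F \<gamma>) (\<pi> \<gamma>)"
    and p: "partial_recursive_in Orc p"
    and code: "\<forall>x \<gamma>. \<nu> x = Some \<gamma> \<longrightarrow>
              (\<exists>(T :: nat ring) h.
                 semiring T \<and> h \<in> semiring_hom T (F \<gamma>) \<and>
                 bij_betw h (carrier T) (carrier (F \<gamma>)) \<and>
                 p [x] = Some (finite_semiring_code T) \<and>
                 (\<forall>y b. \<nu> y = Some b \<longrightarrow>
                    (\<exists>t\<in>carrier T. q [x, y] = Some t \<and> h t = \<pi> \<gamma> b)))"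
    using assms unfolding effectively_separated_def by blast
  have "\<exists>y. p [x] = Some y \<and> upper_rep y (card (carrier (F \<gamma>)))" if x: "elem_rep \<nu> x \<gamma>" for x \<gamma>
  proof -
    obtain T :: "nat ring" and h where T: "bij_betw h (carrier T) (carrier (F \<gamma>))"
        "p [x] = Some (finite_semiring_code T)"
      using code x unfolding elem_rep_def by blast
    show ?thesis
    proof (cases "finite (carrier T)")
      case True
      then show ?thesis
        using T card_le_finite_semiring_code[OF True] bij_betw_same_card[OF T(1)]
        by (simp add: upper_rep_def)
    next
      case False
      then have "card (carrier (F \<gamma>)) = 0"
        using bij_betw_same_card[OF T(1)] by simp
      with T(2) show ?thesis
        by (simp add: upper_rep_def)
    qed
  qed
  with p have "realizable Orc (elem_rep \<nu>) upper_rep (\<lambda>\<gamma>. card (carrier (F \<gamma>)))"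
    unfolding realizable_def by blast
  with sep show ?thesis
    by blast
qed

context represented_semiring
begin

lemma matrix_reachable_decidable:
  assumes "effectively_separated S \<nu> oracles"
  shows "decidable_in oracles (matrix_instance \<nu>) (matrix_reachable S)"
proof -
  obtain F \<pi> where sep: "\<And>\<gamma>. \<gamma> \<in> carrier S \<Longrightarrow> separates S \<gamma> (F \<gamma> :: nat ring) (\<pi> \<gamma>)"
    and size: "realizable oracles (elem_rep \<nu>) upper_rep (\<lambda>\<gamma>. card (carrier (F \<gamma>)))"
    using effectively_separated_size_bound[OF assms] by blast
  let ?wf = "\<lambda>(n, As, M). set As \<subseteq> mats_over S n n \<and> M \<in> mats_over S n n"
  let ?R = "restrict_rep (nat_rep \<times>\<^sub>r list_rep (codes_mat \<nu>) \<times>\<^sub>r codes_mat \<nu>) ?wf"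
  let ?n = "\<lambda>e :: nat \<times> 'a mat list \<times> 'a mat. fst e"
  let ?As = "\<lambda>e :: nat \<times> 'a mat list \<times> 'a mat. fst (snd e)"
  let ?M = "\<lambda>e :: nat \<times> 'a mat list \<times> 'a mat. snd (snd e)"
  have n: "realizable oracles ?R nat_rep ?n"
    and As: "realizable oracles ?R (list_rep (codes_mat \<nu>)) ?As"
    and M: "realizable oracles ?R (codes_mat \<nu>) ?M"
    by (rule realizable_fst realizable_snd realizable_restrict)+
  have wf: "set (?As e) \<subseteq> mats_over S (?n e) (?n e)" "?M e \<in> mats_over S (?n e) (?n e)"
    if "?R x e" for x e
    using that by (auto simp: restrict_rep_def)
  have "realizable oracles ?R bool_rep (\<lambda>e. \<exists>l. \<exists>X\<in>set (reached (?n e) (?n e) (?As e) (?As e) l).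
      entries_agree (?n e) (?n e) X (?M e))"
  proof (rule realizable_search[OF sep size n n n n As As M _ wf(1) wf(1) wf(2)])
    show "realizable oracles (codes_mat \<nu> \<times>\<^sub>r ?R) bool_rep
        (\<lambda>p. entries_agree (?n (snd p)) (?n (snd p)) (fst p) (?M (snd p)))"
      by (rule realizable_entries_agree realizable_comp[OF _ n] realizable_comp[OF _ M] realizable_proj)+
  next
    fix x e X Y
    assume R: "?R x e" and X: "X \<in> mats_over S (?n e) (?n e)" "Y \<in> mats_over S (?n e) (?n e)"
      and goal: "entries_agree (?n e) (?n e) X (?M e)"
      and eq: "\<And>a b i j. a < ?n e \<Longrightarrow> b < ?n e \<Longrightarrow> i < ?n e \<Longrightarrow> j < ?n e \<Longrightarrow>
        \<pi> (?M e $$ (a, b)) (X $$ (i, j)) = \<pi> (?M e $$ (a, b)) (Y $$ (i, j))"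
    have "X = ?M e"
      using goal entries_agree_iff[OF X(1) wf(2)[OF R]] by simp
    then have "Y $$ (i, j) = ?M e $$ (i, j)" if "i < ?n e" "j < ?n e" for i j
      using that eq[of i j i j] X
      by (intro separating_eq[OF sep size]) (auto simp: mats_over_def)
    then show "entries_agree (?n e) (?n e) Y (?M e)"
      unfolding entries_agree_iff[OF X(2) wf(2)[OF R]]
      using X(2) wf(2)[OF R] by (intro eq_matI) (auto simp: mats_over_def)
  qed assumption+
  then have "realizable oracles ?R bool_rep (matrix_reachable S)"
  proof (rule realizable_mono)
    fix x e y
    assume R: "?R x e"
    have "(\<exists>l. \<exists>X\<in>set (reached (?n e) (?n e) (?As e) (?As e) l). entries_agree (?n e) (?n e) X (?M e))
        \<longleftrightarrow> (\<exists>w\<in>words (length (?As e)). entries_agree (?n e) (?n e) (word_prod S (?As e) w) (?M e))"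
      by (rule ex_reached_iff_word[OF wf(1)[OF R] wf(1)[OF R]])
        (auto simp: word_prod_singleton word_prod_snoc in_set_conv_nth)
    also have "\<dots> \<longleftrightarrow> matrix_reachable S e"
      using entries_agree_iff[OF word_prod_closed[OF wf(1)[OF R]] wf(2)[OF R]]
      by (auto simp: matrix_reachable_def split: prod.splits)
    finally show "bool_rep y (matrix_reachable S e)" if "bool_rep y
        (\<exists>l. \<exists>X\<in>set (reached (?n e) (?n e) (?As e) (?As e) l). entries_agree (?n e) (?n e) X (?M e))"
      using that by simp
  qed
  then show ?thesis
    by (rule decidable_in_if_realizable[where k = 2])
      (auto elim!: matrix_instance.cases simp: restrict_rep_def prod_rep_def nat_rep_def
        codes_mats_eq_list_rep intro: mem_mats_over_if_coded mats_over_if_coded)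
qed

lemma vector_reachable_decidable:
  assumes "effectively_separated S \<nu> oracles"
  shows "decidable_in oracles (vector_instance \<nu>) (vector_reachable S)"
proof -
  obtain F \<pi> where sep: "\<And>\<gamma>. \<gamma> \<in> carrier S \<Longrightarrow> separates S \<gamma> (F \<gamma> :: nat ring) (\<pi> \<gamma>)"
    and size: "realizable oracles (elem_rep \<nu>) upper_rep (\<lambda>\<gamma>. card (carrier (F \<gamma>)))"
    using effectively_separated_size_bound[OF assms] by blast
  let ?wf = "\<lambda>(n, As, \<alpha>, \<eta>). set As \<subseteq> mats_over S n n \<and> \<alpha> \<in> mats_over S 1 n \<and> \<eta> \<in> mats_over S 1 n"
  let ?R = "restrict_rep (nat_rep \<times>\<^sub>r list_rep (codes_mat \<nu>) \<times>\<^sub>r codes_mat \<nu> \<times>\<^sub>r codes_mat \<nu>) ?wf"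
  let ?n = "\<lambda>e :: nat \<times> 'a mat list \<times> 'a mat \<times> 'a mat. fst e"
  let ?As = "\<lambda>e :: nat \<times> 'a mat list \<times> 'a mat \<times> 'a mat. fst (snd e)"
  let ?\<alpha> = "\<lambda>e :: nat \<times> 'a mat list \<times> 'a mat \<times> 'a mat. fst (snd (snd e))"
  let ?\<eta> = "\<lambda>e :: nat \<times> 'a mat list \<times> 'a mat \<times> 'a mat. snd (snd (snd e))"
  let ?Is = "\<lambda>e. row_times (?n e) (?\<alpha> e) (?As e)"
  have n: "realizable oracles ?R nat_rep ?n"
    and As: "realizable oracles ?R (list_rep (codes_mat \<nu>)) ?As"
    and \<alpha>: "realizable oracles ?R (codes_mat \<nu>) ?\<alpha>"
    and \<eta>: "realizable oracles ?R (codes_mat \<nu>) ?\<eta>"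
    by (rule realizable_fst realizable_snd realizable_restrict)+
  have wf: "set (?As e) \<subseteq> mats_over S (?n e) (?n e)" "?\<alpha> e \<in> mats_over S 1 (?n e)"
      "?\<eta> e \<in> mats_over S 1 (?n e)"
    if "?R x e" for x e
    using that by (auto simp: restrict_rep_def)
  have wf_Is: "set (?Is e) \<subseteq> mats_over S 1 (?n e)" if "?R x e" for x e
    unfolding set_row_times[OF wf(2,1)[OF that]]
    using mat_mult_closed[OF wf(2)[OF that]] wf(1)[OF that] by blast
  have "realizable oracles ?R bool_rep (\<lambda>e. \<exists>l. \<exists>X\<in>set (reached 1 (?n e) (?As e) (?Is e) l).
      entries_agree 1 (?n e) X (?\<eta> e))"
  proof (rule realizable_search[OF sep size realizable_1 n realizable_1 n As
        realizable_row_times[OF n \<alpha> As] \<eta> _ wf(1) wf_Is wf(3)])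
    show "realizable oracles (codes_mat \<nu> \<times>\<^sub>r ?R) bool_rep
        (\<lambda>p. entries_agree 1 (?n (snd p)) (fst p) (?\<eta> (snd p)))"
      by (rule realizable_entries_agree realizable_1 realizable_comp[OF _ n] realizable_comp[OF _ \<eta>]
          realizable_proj)+
  next
    fix x e X Y
    assume R: "?R x e" and X: "X \<in> mats_over S 1 (?n e)" "Y \<in> mats_over S 1 (?n e)"
      and goal: "entries_agree 1 (?n e) X (?\<eta> e)"
      and eq: "\<And>a b i j. a < 1 \<Longrightarrow> b < ?n e \<Longrightarrow> i < 1 \<Longrightarrow> j < ?n e \<Longrightarrow>
        \<pi> (?\<eta> e $$ (a, b)) (X $$ (i, j)) = \<pi> (?\<eta> e $$ (a, b)) (Y $$ (i, j))"
    have "X = ?\<eta> e"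
      using goal entries_agree_iff[OF X(1) wf(3)[OF R]] by simp
    then have "Y $$ (i, j) = ?\<eta> e $$ (i, j)" if "i < 1" "j < ?n e" for i j
      using that eq[of i j i j] X
      by (intro separating_eq[OF sep size]) (auto simp: mats_over_def)
    then show "entries_agree 1 (?n e) Y (?\<eta> e)"
      unfolding entries_agree_iff[OF X(2) wf(3)[OF R]]
      using X(2) wf(3)[OF R] by (intro eq_matI) (auto simp: mats_over_def)
  qed assumption+
  then have "realizable oracles ?R bool_rep (vector_reachable S)"
  proof (rule realizable_mono)
    fix x e y
    assume R: "?R x e"
    have "(\<exists>l. \<exists>X\<in>set (reached 1 (?n e) (?As e) (?Is e) l). entries_agree 1 (?n e) X (?\<eta> e))
        \<longleftrightarrow> (\<exists>w\<in>words (length (?As e)).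
          entries_agree 1 (?n e) (mat_mult S (?\<alpha> e) (word_prod S (?As e) w)) (?\<eta> e))"
      by (rule ex_reached_row_times_iff_word[OF wf(2,1)[OF R]])
    also have "\<dots> \<longleftrightarrow> vector_reachable S e"
      using entries_agree_iff[OF mat_mult_closed[OF wf(2)[OF R] word_prod_closed[OF wf(1)[OF R]]]
          wf(3)[OF R]]
      by (auto simp: vector_reachable_def split: prod.splits)
    finally show "bool_rep y (vector_reachable S e)" if "bool_rep y
        (\<exists>l. \<exists>X\<in>set (reached 1 (?n e) (?As e) (?Is e) l). entries_agree 1 (?n e) X (?\<eta> e))"
      using that by simp
  qed
  then show ?thesis
    by (rule decidable_in_if_realizable[where k = 3])
      (auto elim!: vector_instance.cases simp: restrict_rep_def prod_rep_def nat_rep_def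
        codes_mats_eq_list_rep intro: mem_mats_over_if_coded mats_over_if_coded)
qed

lemma scalar_reachable_decidable:
  assumes "effectively_separated S \<nu> oracles"
  shows "decidable_in oracles (scalar_instance \<nu>) (scalar_reachable S)"
proof -
  obtain F \<pi> where sep: "\<And>\<gamma>. \<gamma> \<in> carrier S \<Longrightarrow> separates S \<gamma> (F \<gamma> :: nat ring) (\<pi> \<gamma>)"
    and size: "realizable oracles (elem_rep \<nu>) upper_rep (\<lambda>\<gamma>. card (carrier (F \<gamma>)))"
    using effectively_separated_size_bound[OF assms] by blast
  obtain z where z: "\<nu> z = Some \<zero>"
    using zero_coded by blast
  let ?wf = "\<lambda>(n, As, \<alpha>, \<beta>, \<gamma>). set As \<subseteq> mats_over S n n \<and> \<alpha> \<in> mats_over S 1 n \<and>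
    \<beta> \<in> mats_over S n 1 \<and> \<gamma> \<in> carrier S"
  let ?R = "restrict_rep (nat_rep \<times>\<^sub>r list_rep (codes_mat \<nu>) \<times>\<^sub>r codes_mat \<nu> \<times>\<^sub>r codes_mat \<nu> \<times>\<^sub>r
    elem_rep \<nu>) ?wf"
  let ?n = "\<lambda>e :: nat \<times> 'a mat list \<times> 'a mat \<times> 'a mat \<times> 'a. fst e"
  let ?As = "\<lambda>e :: nat \<times> 'a mat list \<times> 'a mat \<times> 'a mat \<times> 'a. fst (snd e)"
  let ?\<alpha> = "\<lambda>e :: nat \<times> 'a mat list \<times> 'a mat \<times> 'a mat \<times> 'a. fst (snd (snd e))"
  let ?\<beta> = "\<lambda>e :: nat \<times> 'a mat list \<times> 'a mat \<times> 'a mat \<times> 'a. fst (snd (snd (snd e)))"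
  let ?\<gamma> = "\<lambda>e :: nat \<times> 'a mat list \<times> 'a mat \<times> 'a mat \<times> 'a. snd (snd (snd (snd e)))"
  let ?Is = "\<lambda>e. row_times (?n e) (?\<alpha> e) (?As e)"
  \<comment> \<open>Only the target \<open>\<gamma>\<close> has to be separated; it is the entry of a \<open>1 \<times> 1\<close> matrix.\<close>
  let ?T = "\<lambda>e. mat 1 1 (\<lambda>(i, j). ?\<gamma> e)"
  let ?goal = "\<lambda>X e. mat_entry \<zero> (sized_mult 1 (?n e) 1 X (?\<beta> e)) 0 0 = ?\<gamma> e"
  have n: "realizable oracles ?R nat_rep ?n"
    and As: "realizable oracles ?R (list_rep (codes_mat \<nu>)) ?As"
    and \<alpha>: "realizable oracles ?R (codes_mat \<nu>) ?\<alpha>"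
    and \<beta>: "realizable oracles ?R (codes_mat \<nu>) ?\<beta>"
    and \<gamma>: "realizable oracles ?R (elem_rep \<nu>) ?\<gamma>"
    by (rule realizable_fst realizable_snd realizable_restrict)+
  have T: "realizable oracles ?R (codes_mat \<nu>) ?T"
    by (rule realizable_mat realizable_1 realizable_comp[OF _ \<gamma>] realizable_proj)+
  have wf: "set (?As e) \<subseteq> mats_over S (?n e) (?n e)" "?\<alpha> e \<in> mats_over S 1 (?n e)"
      "?\<beta> e \<in> mats_over S (?n e) 1" "?\<gamma> e \<in> carrier S"
    if "?R x e" for x e
    using that by (auto simp: restrict_rep_def)
  have wf_T: "?T e \<in> mats_over S 1 1" if "?R x e" for x e
    using wf(4)[OF that] by (auto simp: mats_over_def)
  have wf_Is: "set (?Is e) \<subseteq> mats_over S 1 (?n e)" if "?R x e" for x e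
    unfolding set_row_times[OF wf(2,1)[OF that]]
    using mat_mult_closed[OF wf(2)[OF that]] wf(1)[OF that] by blast
  have goal_iff: "?goal X e \<longleftrightarrow> mat_mult S X (?\<beta> e) $$ (0, 0) = ?\<gamma> e"
    if "?R x e" "X \<in> mats_over S 1 (?n e)" for x e X
  proof -
    have "mat_mult S X (?\<beta> e) \<in> carrier_mat 1 1"
      using mat_mult_closed[OF that(2) wf(3)[OF that(1)]] by (simp add: mats_over_def)
    then show ?thesis
      using that(2) wf(3)[OF that(1)] by (simp add: sized_mult_eq mat_entry_eq)
  qed
  have "realizable oracles ?R bool_rep (\<lambda>e. \<exists>l. \<exists>X\<in>set (reached 1 (?n e) (?As e) (?Is e) l). ?goal X e)"
  proof (rule realizable_search[OF sep size realizable_1 n realizable_1 realizable_1 As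
        realizable_row_times[OF n \<alpha> As] T _ wf(1) wf_Is wf_T])
    show "realizable oracles (codes_mat \<nu> \<times>\<^sub>r ?R) bool_rep (\<lambda>p. ?goal (fst p) (snd p))"
      by (rule realizable_eq realizable_mat_entry realizable_sized_mult realizable_0 realizable_1
          realizable_comp[OF _ n] realizable_comp[OF _ \<beta>] realizable_comp[OF _ \<gamma>] z realizable_proj)+
  next
    fix x e X Y
    assume R: "?R x e" and X: "X \<in> mats_over S 1 (?n e)" "Y \<in> mats_over S 1 (?n e)"
      and goal: "?goal X e"
      and eq: "\<And>a b i j. a < 1 \<Longrightarrow> b < 1 \<Longrightarrow> i < 1 \<Longrightarrow> j < ?n e \<Longrightarrow>
        \<pi> (?T e $$ (a, b)) (X $$ (i, j)) = \<pi> (?T e $$ (a, b)) (Y $$ (i, j))"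
    have "\<pi> (?\<gamma> e) (mat_mult S X (?\<beta> e) $$ (0, 0)) = \<pi> (?\<gamma> e) (mat_mult S Y (?\<beta> e) $$ (0, 0))"
      using eq[of 0 0]
      by (intro hom_mat_mult_cong[OF separating_hom[OF sep size wf(4)[OF R]] X wf(3)[OF R]]) auto
    then have "\<pi> (?\<gamma> e) (mat_mult S Y (?\<beta> e) $$ (0, 0)) = \<pi> (?\<gamma> e) (?\<gamma> e)"
      using goal goal_iff[OF R X(1)] by simp
    then have "mat_mult S Y (?\<beta> e) $$ (0, 0) = ?\<gamma> e"
      using mat_mult_closed[OF X(2) wf(3)[OF R]]
      by (intro separating_eq[OF sep size wf(4)[OF R]]) (auto simp: mats_over_def)
    then show "?goal Y e"
      using goal_iff[OF R X(2)] by simp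
  qed assumption+
  then have "realizable oracles ?R bool_rep (scalar_reachable S)"
  proof (rule realizable_mono)
    fix x e y
    assume R: "?R x e"
    have "(\<exists>l. \<exists>X\<in>set (reached 1 (?n e) (?As e) (?Is e) l). ?goal X e)
        \<longleftrightarrow> (\<exists>w\<in>words (length (?As e)). ?goal (mat_mult S (?\<alpha> e) (word_prod S (?As e) w)) e)"
      by (rule ex_reached_row_times_iff_word[OF wf(2,1)[OF R]])
    also have "\<dots> \<longleftrightarrow> scalar_reachable S e"
      using goal_iff[OF R mat_mult_closed[OF wf(2)[OF R] word_prod_closed[OF wf(1)[OF R]]]]
      by (auto simp: scalar_reachable_def split: prod.splits)
    finally show "bool_rep y (scalar_reachable S e)" if "bool_rep y
        (\<exists>l. \<exists>X\<in>set (reached 1 (?n e) (?As e) (?Is e) l). ?goal X e)"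
      using that by simp
  qed
  then show ?thesis
    by (rule decidable_in_if_realizable[where k = 4])
      (auto elim!: scalar_instance.cases simp: restrict_rep_def prod_rep_def nat_rep_def elem_rep_def
        codes_mats_eq_list_rep ran_repr[symmetric] intro: mem_mats_over_if_coded mats_over_if_coded ranI)
qed

end

theorem theorem4:
  fixes S :: "('a, 'm) ring_scheme"
    and \<nu> :: "nat \<rightharpoonup> 'a"
    and add_orc mult_orc eq_orc :: "nat list \<rightharpoonup> nat"
  assumes "represented_semiring S \<nu> add_orc mult_orc eq_orc"
    and "effectively_separated S \<nu> {add_orc, mult_orc, eq_orc}"
  shows "decidable_in {add_orc, mult_orc, eq_orc} (matrix_instance \<nu>) (matrix_reachable S) \<and>
    decidable_in {add_orc, mult_orc, eq_orc} (vector_instance \<nu>) (vector_reachable S) \<and>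
    decidable_in {add_orc, mult_orc, eq_orc} (scalar_instance \<nu>) (scalar_reachable S)"
proof -
  interpret represented_semiring S \<nu> add_orc mult_orc eq_orc
    by (fact assms(1))
  show ?thesis
    using matrix_reachable_decidable vector_reachable_decidable scalar_reachable_decidable assms(2)
    by blast
qed

end
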